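(* Let $\gamma=\gamma(n)$ with $0\le\gamma\le\frac14$, and let $\mathcal{P}=\mathcal{P}_n$ be the planted model with signal parameter $\gamma(n)$. The following hold (asymptotics as $n\to\infty$): 1. If $\gamma=\omega(n^{-1/2})$, then a polynomial-time algorithm achieves strong recovery of the planted permutation. 2. If $\gamma=\Theta(n^{-1/2})$, then no algorithm (of any running time) achieves strong recovery of the planted permutation. 3. If $\gamma=\Theta(n^{-1/2})$, then a polynomial-time algorithm achieves weak recovery of the planted permutation. 4. If $\gamma=o(n^{-1/2})$, then no algorithm (of any running time) achieves weak recovery of the planted permutation.
   Context: A tournament on $n$ vertices is identified with its tournament matrix $T\in\{-1,0,1\}^{n\times n}$, which is skew-symmetric with zero diagonal and off-diagonal entries $T_{i,j}=-T_{j,i}\in\{\pm1\}$. Planted model $\mathcal{P}$ with signal parameter $\gamma\in[0,\frac12]$: draw a hidden (planted) permutation $\pi$ uniformly from the symmetric group $S_n$; conditionally on $\pi$, independently for each pair $i,j$ with $\pi(i)<\pi(j)$, set $T_{i,j}=-T_{j,i}=+1$ with probability $\frac12+\gamma$ and $-1$ with probability $\frac12-\gamma$. We write $(T,\pi)\sim\mathcal{P}$. Kendall tau distance: for $\pi_1,\pi_2\in S_n$, $d(\pi_1,\pi_2)=\sum_{(i,j):\,\pi_1(i)<\pi_1(j)}\mathbf{1}\{\pi_2(i)>\pi_2(j)\}$. An algorithm taking as input a tournament $T$ on $n$ vertices and outputting a permutation $\hat\pi=\hat\pi(T)\in S_n$ achieves weak recovery if there is a constant $\delta>0$ with $$\limsup_{n\to\infty}\frac{\mathbb{E}_{(T,\pi)\sim\mathcal{P}}[d(\pi,\hat\pi)]}{\binom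 n2}\le\frac12-\delta,$$ and achieves strong recovery if $$\lim_{n\to\infty}\frac{\mathbb{E}_{(T,\pi)\sim\mathcal{P}}[d(\pi,\hat\pi)]}{\binom n2}=0.$$ *)

theory Defs
  imports
    "HOL-Probability.Probability"
    "HOL-Library.Landau_Symbols"
    "HOL-Computational_Algebra.Polynomial"
begin

section \<open>Tournaments, the planted model and Kendall tau distance\<close>

text \<open>
  Vertices are \<open>0, \<dots>, n - 1\<close>. An \<open>n \<times> n\<close> matrix is a function of two indices that vanishes
  outside the index range, so that equality of matrices is equality of functions. The symmetric
  group is the set of \<open>\<pi>\<close> with \<open>\<pi> permutes {..<n}\<close>.
\<close>

type_synonym matrix = "nat \<Rightarrow> nat \<Rightarrow> int"

definition tournament :: "nat \<Rightarrow> matrix \<Rightarrow> bool" where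
  "tournament n T \<longleftrightarrow>
     (\<forall>i j. T i j = - T j i) \<and>
     (\<forall>i<n. \<forall>j<n. i \<noteq> j \<longrightarrow> T i j \<in> {-1, 1}) \<and>
     (\<forall>i j. \<not> (i < n \<and> j < n) \<longrightarrow> T i j = 0)"

definition ordered_pairs :: "nat \<Rightarrow> (nat \<Rightarrow> nat) \<Rightarrow> (nat \<times> nat) set" where
  "ordered_pairs n \<pi> = {(i, j). i < n \<and> j < n \<and> \<pi> i < \<pi> j}"

text \<open>
  The independent signs \<open>X (i, j)\<close> are drawn for the pairs with \<open>\<pi> i < \<pi> j\<close>, and \<open>X\<close> is \<open>0\<close>
  elsewhere. Hence \<open>X (i, j) - X (j, i)\<close> is \<open>X (i, j)\<close> if \<open>\<pi> i < \<pi> j\<close>, it is \<open>- X (j, i)\<close> if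
  \<open>\<pi> j < \<pi> i\<close>, and it is \<open>0\<close> on the diagonal and outside the index range.
\<close>

definition planted :: "nat \<Rightarrow> real \<Rightarrow> (matrix \<times> (nat \<Rightarrow> nat)) pmf" where
  "planted n \<gamma> = do {
     \<pi> \<leftarrow> pmf_of_set {\<pi>. \<pi> permutes {..<n}};
     X \<leftarrow> Pi_pmf (ordered_pairs n \<pi>) 0
            (\<lambda>_. map_pmf (\<lambda>b. if b then 1 else - 1) (bernoulli_pmf (1 / 2 + \<gamma>)));
     return_pmf (\<lambda>i j. X (i, j) - X (j, i), \<pi>)
   }"

definition kendall_tau :: "nat \<Rightarrow> (nat \<Rightarrow> nat) \<Rightarrow> (nat \<Rightarrow> nat) \<Rightarrow> nat" where
  "kendall_tau n \<pi>1 \<pi>2 = (\<Sum>(i, j)\<in>ordered_pairs n \<pi>1. of_bool (\<pi>2 i > \<pi>2 j))"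


section \<open>Algorithms and recovery\<close>

text \<open>
  An algorithm of unbounded running time is an arbitrary function from tournaments to permutations;
  its values on matrices that are not tournaments are irrelevant.
\<close>

type_synonym estimator = "nat \<Rightarrow> matrix \<Rightarrow> nat \<Rightarrow> nat"

definition algorithm :: "estimator \<Rightarrow> bool" where
  "algorithm A \<longleftrightarrow> (\<forall>n T. tournament n T \<longrightarrow> A n T permutes {..<n})"

definition recovery_error :: "(nat \<Rightarrow> real) \<Rightarrow> estimator \<Rightarrow> nat \<Rightarrow> real" where
  "recovery_error \<gamma> A n =
     measure_pmf.expectation (planted n (\<gamma> n)) (\<lambda>(T, \<pi>). real (kendall_tau n \<pi> (A n T)))
       / real (n choose 2)"

definition weak_recovery :: "(nat \<Rightarrow> real) \<Rightarrow> estimator \<Rightarrow> bool" where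
  "weak_recovery \<gamma> A \<longleftrightarrow>
     (\<exists>\<delta>>0. limsup (\<lambda>n. ereal (recovery_error \<gamma> A n)) \<le> ereal (1 / 2 - \<delta>))"

definition strong_recovery :: "(nat \<Rightarrow> real) \<Rightarrow> estimator \<Rightarrow> bool" where
  "strong_recovery \<gamma> A \<longleftrightarrow> recovery_error \<gamma> A \<longlonglongrightarrow> 0"


section \<open>Polynomial time\<close>

text \<open>
  The machine model is a random access machine with structured control flow. A program names
  finitely many registers, and further memory cells are reached through addresses held in registers;
  both hold natural numbers. Every instruction and every test costs one time unit.
  As the only arithmetic operations are addition and truncated subtraction (no multiplication), one
  instruction increases the bit length of the largest number present by at most one (apart from the
  fixed constants of the program), so that
  polynomial time with this uniform cost measure agrees with polynomial time under logarithmic cost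
  and with polynomial time on Turing machines.
\<close>

datatype com =
    Skip
  | Const nat nat
  | Add nat nat nat
  | Sub nat nat nat
  | Load nat nat
  | Store nat nat
  | Seq com com
  | If nat com com
  | While nat com

type_synonym state = "(nat \<Rightarrow> nat) \<times> (nat \<Rightarrow> nat)"

text \<open>
  \<open>exec c s k s'\<close>: started in the state \<open>s\<close> (registers and memory), the program \<open>c\<close> halts after
  exactly \<open>k\<close> steps in the state \<open>s'\<close>. Tests are for being nonzero.
\<close>

inductive exec :: "com \<Rightarrow> state \<Rightarrow> nat \<Rightarrow> state \<Rightarrow> bool" where
  Skip: "exec Skip s 1 s"
| Const: "exec (Const x c) (r, m) 1 (r(x := c), m)"
| Add: "exec (Add x y z) (r, m) 1 (r(x := r y + r z), m)"
| Sub: "exec (Sub x y z) (r, m) 1 (r(x := r y - r z), m)"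
| Load: "exec (Load x a) (r, m) 1 (r(x := m (r a)), m)"
| Store: "exec (Store a x) (r, m) 1 (r, m(r a := r x))"
| Seq: "exec c1 s k1 s' \<Longrightarrow> exec c2 s' k2 s'' \<Longrightarrow> exec (Seq c1 c2) s (k1 + k2) s''"
| If_True: "r x \<noteq> 0 \<Longrightarrow> exec c1 (r, m) k s \<Longrightarrow> exec (If x c1 c2) (r, m) (1 + k) s"
| If_False: "r x = 0 \<Longrightarrow> exec c2 (r, m) k s \<Longrightarrow> exec (If x c1 c2) (r, m) (1 + k) s"
| While_False: "r x = 0 \<Longrightarrow> exec (While x c) (r, m) 1 (r, m)"
| While_True: "r x \<noteq> 0 \<Longrightarrow> exec c (r, m) k1 s' \<Longrightarrow> exec (While x c) s' k2 s'' \<Longrightarrow>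
    exec (While x c) (r, m) (1 + k1 + k2) s''"

inductive_cases exec_SkipE: "exec Skip s k s'"
inductive_cases exec_ConstE: "exec (Const x c) s k s'"
inductive_cases exec_AddE: "exec (Add x y z) s k s'"
inductive_cases exec_SubE: "exec (Sub x y z) s k s'"
inductive_cases exec_LoadE: "exec (Load x a) s k s'"
inductive_cases exec_StoreE: "exec (Store a x) s k s'"
inductive_cases exec_SeqE: "exec (Seq c1 c2) s k s'"
inductive_cases exec_IfE: "exec (If x c1 c2) s k s'"
inductive_cases exec_WhileE: "exec (While x c) s k s'"

lemma exec_deterministic:
  "exec c s k1 s1 \<Longrightarrow> exec c s k2 s2 \<Longrightarrow> k1 = k2 \<and> s1 = s2"
proof (induction arbitrary: k2 s2 rule: exec.induct)
  case (Seq c1 s k1 s' c2 k2' s'')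
  from Seq.prems show ?case
  proof (rule exec_SeqE)
    fix l1 t l2
    assume k2: "k2 = l1 + l2" and 1: "exec c1 s l1 t" and 2: "exec c2 t l2 s2"
    from Seq.IH(1)[OF 1] have *: "k1 = l1" "s' = t" by simp_all
    from Seq.IH(2)[of l2 s2] 2 show ?thesis unfolding * k2 by simp
  qed
next
  case (While_True r x c m k1 s' k2' s'')
  from While_True.prems show ?case
  proof (rule exec_WhileE)
    fix r' m' assume "(r, m) = (r', m')" "r' x = 0"
    with While_True.hyps(1) show ?thesis by simp
  next
    fix r' m' l1 t l2
    assume "(r, m) = (r', m')" and k2: "k2 = Suc (l1 + l2)"
      and "exec c (r', m') l1 t" and 2: "exec (While x c) t l2 s2"
    then have 1: "exec c (r, m) l1 t" by simp
    from While_True.IH(1)[OF 1] have *: "k1 = l1" "s' = t" by simp_all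
    from While_True.IH(2)[of l2 s2] 2 show ?thesis unfolding * k2 by simp
  qed
next
  case (If_True r x c1 m k s c2)
  from If_True.prems show ?case
    by (rule exec_IfE) (use If_True.hyps(1) If_True.IH in simp_all)
next
  case (If_False r x c2 m k s c1)
  from If_False.prems show ?case
    by (rule exec_IfE) (use If_False.hyps(1) If_False.IH in simp_all)
next
  case (While_False r x c m)
  from While_False.prems show ?case
    by (rule exec_WhileE) (use While_False.hyps(1) in simp_all)
next
  case (Skip s)
  from Skip.prems show ?case
    by (rule exec_SkipE) simp
next
  case (Const x c r m)
  from Const.prems show ?case
    by (rule exec_ConstE) simp
next
  case (Add x y z r m)
  from Add.prems show ?case
    by (rule exec_AddE) simp
next
  case (Sub x y z r m)
  from Sub.prems show ?case
    by (rule exec_SubE) simp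
next
  case (Load x a r m)
  from Load.prems show ?case
    by (rule exec_LoadE) simp
next
  case (Store a x r m)
  from Store.prems show ?case
    by (rule exec_StoreE) simp
qed

text \<open>
  Register \<open>0\<close> initially holds \<open>n\<close>, and the memory holds the matrix row by row with the entries
  \<open>-1, 0, 1\<close> encoded as \<open>0, 1, 2\<close>; everything else is \<open>0\<close>.
\<close>

definition input_state :: "nat \<Rightarrow> matrix \<Rightarrow> state" where
  "input_state n T =
     ((\<lambda>_. 0)(0 := n),
      \<lambda>a. if a < n * n then nat (T (a div n) (a mod n) + 1) else 0)"

text \<open>
  A single program works for all \<open>n\<close>; it leaves the output permutation in the memory cells
  \<open>0, \<dots>, n - 1\<close>. As the input consists of \<open>n\<^sup>2\<close> symbols, a polynomial bound in the input size is the
  same as a polynomial bound in \<open>n\<close>.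
\<close>

definition polynomial_time :: "estimator \<Rightarrow> bool" where
  "polynomial_time A \<longleftrightarrow>
     (\<exists>(c :: com) (p :: nat poly). \<forall>n T. tournament n T \<longrightarrow>
        (\<exists>k r m. k \<le> poly p n \<and> exec c (input_state n T) k (r, m) \<and> (\<forall>i<n. m i = A n T i)))"

end

theory Submission
  imports Defs
begin

text \<open>
  The algorithm ranks the players by their number of wins. Exchanging the positions of two players
  \<open>i\<close>, \<open>j\<close> in the planted permutation is a bijection between the permutations with \<open>\<pi> i < \<pi> j\<close> and
  those with \<open>\<pi> j < \<pi> i\<close>, which turns the expected Kendall distance into a sum of two-point
  testing problems between \<open>\<pi>\<close> and \<open>\<pi> \<circ> (i j)\<close>.

  For the lower bounds, the two laws of the tournament differ in at most \<open>4 n\<close> entries, so the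
  square of their Bhattacharyya coefficient is at least \<open>b = (1 - 4 \<gamma>\<^sup>2) ^ (4 n)\<close>, and by
  Cauchy--Schwarz every test has total error at least \<open>1 - sqrt (1 - b)\<close>.

  For the upper bounds, the error of ranking by wins at the pair \<open>i\<close>, \<open>j\<close> is \<open>1 - E sgn D\<close>, where
  \<open>D\<close> is the difference of the scores, of mean \<open>4 \<gamma> (\<pi> j - \<pi> i)\<close> and variance \<open>O(n)\<close>. Chebyshev's
  inequality gives strong recovery. For weak recovery, symmetrisation shows that \<open>E sgn D \<ge> 0\<close>, and
  that \<open>E sgn D\<close> is bounded below if almost all players are between \<open>i\<close> and \<open>j\<close>: then \<open>sgn D\<close> mostly
  agrees with the likelihood ratio test, whose advantage is controlled by the first two moments of
  the log-likelihood ratio.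
\<close>

section \<open>Likelihoods of tournaments\<close>

text \<open>For \<open>\<gamma>\<close> of order \<open>n powr (- 1 / 2)\<close> the mean and the
  standard deviation of a score difference can both be of order \<open>sqrt n\<close>, so
  Chebyshev's inequality says nothing once the constant is small. A normal approximation would be
  the usual remedy. Comparison with the likelihood ratio test replaces it: only the difference of
  the likelihoods under \<open>\<pi>\<close> and \<open>\<pi> \<circ> swap i j\<close> enters, and
  moments of a truncated statistic bound it from below. The obstacle is the contribution of the
  players who are not between \<open>i\<close> and \<open>j\<close>. It carries no information on
  the order of the two, and its standard deviation is about the root of the number of these players.
  It is harmless only if one of \<open>i\<close>, \<open>j\<close> is among the first and the other
  among the last \<open>\<eta> n\<close> positions, with \<open>\<eta>\<close> small in terms of the
  constants of \<open>\<Theta>\<close>. Such pairs are a fixed fraction of all pairs; the others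
  only have to be no worse than guessing, which the symmetrisation provides.\<close>

definition tournaments :: "nat \<Rightarrow> matrix set" where
  "tournaments n = {T. tournament n T}"

text \<open>As \<open>T a b\<close> is a sign, each factor is the probability of the observed
  outcome; being affine in the entry, it needs no case distinction.\<close>

definition likelihood :: "nat \<Rightarrow> real \<Rightarrow> (nat \<Rightarrow> nat) \<Rightarrow> matrix \<Rightarrow> real" where
  "likelihood n \<gamma> \<pi> T = (\<Prod>(a, b)\<in>ordered_pairs n \<pi>. 1 / 2 + \<gamma> * T a b)"

text \<open>The expectation given \<open>\<pi>\<close> as a finite weighted sum, which keeps
  measurability and integrability out of the estimates.\<close>

definition mean :: "nat \<Rightarrow> real \<Rightarrow> (nat \<Rightarrow> nat) \<Rightarrow> (matrix \<Rightarrow> real) \<Rightarrow> real" where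
  "mean n \<gamma> \<pi> f = (\<Sum>T\<in>tournaments n. likelihood n \<gamma> \<pi> T * f T)"

abbreviation perms :: "nat \<Rightarrow> (nat \<Rightarrow> nat) set" where
  "perms n \<equiv> {\<pi>. \<pi> permutes {..<n}}"

lemma card_perms: "card (perms n) = fact n"
  by (rule card_permutations) auto

lemma finite_ordered_pairs [simp]: "finite (ordered_pairs n \<pi>)"
  by (rule finite_subset[of _ "{..<n} \<times> {..<n}"]) (auto simp: ordered_pairs_def)

lemma ordered_pairs_asym: "(a, b) \<in> ordered_pairs n \<pi> \<Longrightarrow> (b, a) \<notin> ordered_pairs n \<pi>"
  by (auto simp: ordered_pairs_def)

lemma ordered_pairs_total:
  assumes "\<pi> permutes {..<n}" "a < n" "b < n" "a \<noteq> b"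
  shows "(a, b) \<in> ordered_pairs n \<pi> \<or> (b, a) \<in> ordered_pairs n \<pi>"
proof -
  have "\<pi> a \<noteq> \<pi> b"
    using permutes_inj[OF assms(1)] assms(4) by (auto simp: inj_def)
  with assms show ?thesis by (auto simp: ordered_pairs_def)
qed

lemma tournament_antisym: "T \<in> tournaments n \<Longrightarrow> T a b = - T b a"
  unfolding tournaments_def tournament_def by blast

lemma tournament_sign:
  assumes "T \<in> tournaments n" "a < n" "b < n" "a \<noteq> b"
  shows "T a b \<in> {-1, 1}"
  using assms unfolding tournaments_def tournament_def by blast

lemma tournament_outside:
  assumes "T \<in> tournaments n" "\<not> (a < n \<and> b < n)"
  shows "T a b = 0"
  using assms unfolding tournaments_def tournament_def by blast

lemma tournament_sign_ordered:
  assumes "T \<in> tournaments n" "p \<in> ordered_pairs n \<pi>"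
  shows "T (fst p) (snd p) \<in> {-1, 1}"
  using assms by (intro tournament_sign) (auto simp: ordered_pairs_def)

section \<open>The law of the tournament given the permutation, as a product of independent
  signs\<close>

definition matrix_of :: "(nat \<times> nat \<Rightarrow> int) \<Rightarrow> matrix" where
  "matrix_of X = (\<lambda>i j. X (i, j) - X (j, i))"

text \<open>The inverse reads off the entries at the pairs ordered by \<open>\<pi>\<close>;
  antisymmetry recovers the rest.\<close>

lemma bij_betw_matrix_of:
  assumes "\<pi> permutes {..<n}"
  shows "bij_betw matrix_of (PiE_dflt (ordered_pairs n \<pi>) 0 (\<lambda>_. {1, -1})) (tournaments n)"
proof (rule bij_betwI[where g = "\<lambda>T p. if p \<in> ordered_pairs n \<pi> then T (fst p) (snd p) else 0"])
  note total = ordered_pairs_total[OF assms]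
  show "matrix_of \<in> PiE_dflt (ordered_pairs n \<pi>) 0 (\<lambda>_. {1, -1}) \<rightarrow> tournaments n"
  proof
    fix X :: "nat \<times> nat \<Rightarrow> int"
    assume X: "X \<in> PiE_dflt (ordered_pairs n \<pi>) 0 (\<lambda>_. {1, -1})"
    have 1: "X p \<in> {1, -1}" if "p \<in> ordered_pairs n \<pi>" for p
      using X that unfolding PiE_dflt_def by blast
    have 0: "X p = 0" if "p \<notin> ordered_pairs n \<pi>" for p
      using X that unfolding PiE_dflt_def by blast
    have "matrix_of X i j \<in> {-1, 1}" if "i < n" "j < n" "i \<noteq> j" for i j
      using total[OF that] 1[of "(i, j)"] 1[of "(j, i)"] 0[of "(i, j)"] 0[of "(j, i)"]
        ordered_pairs_asym[of i j] ordered_pairs_asym[of j i]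
      by (auto simp: matrix_of_def)
    moreover have "matrix_of X i j = 0" if "\<not> (i < n \<and> j < n)" for i j
      using 0[of "(i, j)"] 0[of "(j, i)"] that by (auto simp: matrix_of_def ordered_pairs_def)
    moreover have "matrix_of X i j = - matrix_of X j i" for i j
      by (simp add: matrix_of_def)
    ultimately show "matrix_of X \<in> tournaments n"
      unfolding tournaments_def tournament_def mem_Collect_eq by blast
  qed
  show "(\<lambda>T p. if p \<in> ordered_pairs n \<pi> then T (fst p) (snd p) else 0)
      \<in> tournaments n \<rightarrow> PiE_dflt (ordered_pairs n \<pi>) 0 (\<lambda>_. {1, -1})"
    using tournament_sign_ordered[of _ n _ \<pi>] by (fastforce simp: PiE_dflt_def)
  show "(\<lambda>p. if p \<in> ordered_pairs n \<pi> then matrix_of X (fst p) (snd p) else 0) = X"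
    if "X \<in> PiE_dflt (ordered_pairs n \<pi>) 0 (\<lambda>_. {1, -1})" for X
  proof
    fix p :: "nat \<times> nat"
    obtain a b where p: "p = (a, b)" by (cases p)
    show "(if p \<in> ordered_pairs n \<pi> then matrix_of X (fst p) (snd p) else 0) = X p"
      using that ordered_pairs_asym[of a b] by (auto simp: p PiE_dflt_def matrix_of_def)
  qed
  show "matrix_of (\<lambda>p. if p \<in> ordered_pairs n \<pi> then T (fst p) (snd p) else 0) = T"
    if "T \<in> tournaments n" for T
  proof (intro ext)
    fix i j
    show "matrix_of (\<lambda>p. if p \<in> ordered_pairs n \<pi> then T (fst p) (snd p) else 0) i j = T i j"
    proof (cases "i < n \<and> j < n \<and> i \<noteq> j")
      case True
      with total[of i j] ordered_pairs_asym[of i j] ordered_pairs_asym[of j i] show ?thesis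
        using tournament_antisym[OF that, of i j] by (auto simp: matrix_of_def)
    next
      case False
      with tournament_outside[OF that, of i j] tournament_antisym[OF that, of i i] show ?thesis
        by (auto simp: matrix_of_def ordered_pairs_def)
    qed
  qed
qed

lemma finite_tournaments [simp]: "finite (tournaments n)"
proof -
  have "finite (PiE_dflt (ordered_pairs n id) (0::int) (\<lambda>_. {1, -1}))"
    by (rule finite_PiE_dflt) auto
  with bij_betw_matrix_of[of id n] show ?thesis
    using bij_betw_finite permutes_id by blast
qed

text \<open>Independence of the matches in combinatorial form: a sum of products over all sign
  patterns factorises. Means, variances and the Bhattacharyya coefficient below are all computed
  through it.\<close>

lemma sum_tournaments_prod:
  fixes g :: "nat \<times> nat \<Rightarrow> int \<Rightarrow> 'a::comm_semiring_1"
  assumes "\<pi> permutes {..<n}"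
  shows "(\<Sum>T\<in>tournaments n. \<Prod>p\<in>ordered_pairs n \<pi>. g p (T (fst p) (snd p))) =
         (\<Prod>p\<in>ordered_pairs n \<pi>. g p 1 + g p (-1))"
proof -
  let ?P = "ordered_pairs n \<pi>"
  have "(\<Sum>T\<in>tournaments n. \<Prod>p\<in>?P. g p (T (fst p) (snd p))) =
        (\<Sum>X\<in>PiE_dflt ?P 0 (\<lambda>_. {1, -1}). \<Prod>p\<in>?P. g p (matrix_of X (fst p) (snd p)))"
    by (rule sum.reindex_bij_betw[OF bij_betw_matrix_of[OF assms], symmetric])
  also have "\<dots> = (\<Sum>X\<in>PiE_dflt ?P 0 (\<lambda>_. {1, -1}). \<Prod>p\<in>?P. g p (X p))"
  proof (intro sum.cong prod.cong refl)
    fix X :: "nat \<times> nat \<Rightarrow> int" and p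
    assume "X \<in> PiE_dflt ?P 0 (\<lambda>_. {1, -1})" and "p \<in> ?P"
    then show "g p (matrix_of X (fst p) (snd p)) = g p (X p)"
      using ordered_pairs_asym[of "fst p" "snd p"] by (auto simp: matrix_of_def PiE_dflt_def)
  qed
  also have "\<dots> = (\<Sum>X\<in>PiE ?P (\<lambda>_. {1, -1}). \<Prod>p\<in>?P. g p (X p))"
    by (rule sum.reindex_bij_witness[where i = "\<lambda>X p. if p \<in> ?P then X p else 0"
          and j = "\<lambda>X. restrict X ?P"])
      (auto simp: PiE_dflt_def fun_eq_iff PiE_def extensional_def Pi_def)
  also have "\<dots> = (\<Prod>p\<in>?P. \<Sum>x\<in>{1, -1}. g p x)"
    by (rule prod_sum_PiE[symmetric]) auto
  finally show ?thesis by simp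
qed

lemma expectation_sign_pmf:
  assumes \<pi>: "\<pi> permutes {..<n}" and \<gamma>: "0 \<le> \<gamma>" "\<gamma> \<le> 1 / 2"
  shows "measure_pmf.expectation (Pi_pmf (ordered_pairs n \<pi>) 0
            (\<lambda>_. map_pmf (\<lambda>b. if b then 1 else - 1) (bernoulli_pmf (1 / 2 + \<gamma>))))
            (\<lambda>X. f (matrix_of X)) = mean n \<gamma> \<pi> f"
proof -
  let ?P = "ordered_pairs n \<pi>"
  let ?q = "map_pmf (\<lambda>b. if b then 1 else - 1 :: int) (bernoulli_pmf (1 / 2 + \<gamma>))"
  let ?S = "PiE_dflt ?P (0::int) (\<lambda>_. {1, -1})"
  have q: "pmf ?q x = 1 / 2 + \<gamma> * x" if "x \<in> {1, -1}" for x
  proof -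
    let ?h = "\<lambda>b. if b then 1 else - 1 :: int"
    have "?h -` {1} = {True}" "?h -` {-1} = {False}"
      by (auto split: if_splits)
    then have "pmf ?q 1 = 1 / 2 + \<gamma>" "pmf ?q (-1) = 1 / 2 - \<gamma>"
      using \<gamma> by (simp_all only: pmf_map measure_pmf_single) simp_all
    with that show ?thesis by auto
  qed
  have fin: "finite ?S"
    by (rule finite_PiE_dflt) auto
  have "measure_pmf.expectation (Pi_pmf ?P 0 (\<lambda>_. ?q)) (\<lambda>X. f (matrix_of X)) =
      (\<Sum>X\<in>?S. pmf (Pi_pmf ?P 0 (\<lambda>_. ?q)) X *\<^sub>R f (matrix_of X))"
  proof (rule integral_measure_pmf[OF fin])
    fix X assume "X \<in> set_pmf (Pi_pmf ?P 0 (\<lambda>_. ?q))"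
    with set_Pi_pmf_subset'[of ?P 0 "\<lambda>_. ?q"] have "X \<in> PiE_dflt ?P 0 (set_pmf \<circ> (\<lambda>_. ?q))"
      by auto
    then show "X \<in> ?S" by (auto simp: PiE_dflt_def split: if_splits)
  qed
  also have "\<dots> = (\<Sum>X\<in>?S. likelihood n \<gamma> \<pi> (matrix_of X) * f (matrix_of X))"
  proof (intro sum.cong refl)
    fix X assume X: "X \<in> ?S"
    have "pmf (Pi_pmf ?P 0 (\<lambda>_. ?q)) X = (\<Prod>p\<in>?P. pmf ?q (X p))"
      using X by (intro pmf_Pi') (auto simp: PiE_dflt_def)
    also have "\<dots> = likelihood n \<gamma> \<pi> (matrix_of X)"
      unfolding likelihood_def
    proof (intro prod.cong refl, clarify)
      fix a b assume ab: "(a, b) \<in> ?P"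
      have "matrix_of X a b = X (a, b)" "X (a, b) \<in> {1, -1}"
        using X ab ordered_pairs_asym[OF ab] by (auto simp: PiE_dflt_def matrix_of_def)
      then show "pmf ?q (X (a, b)) = 1 / 2 + \<gamma> * matrix_of X a b"
        using q by simp
    qed
    finally show "pmf (Pi_pmf ?P 0 (\<lambda>_. ?q)) X *\<^sub>R f (matrix_of X) =
        likelihood n \<gamma> \<pi> (matrix_of X) * f (matrix_of X)" by simp
  qed
  also have "\<dots> = mean n \<gamma> \<pi> f"
    unfolding mean_def by (rule sum.reindex_bij_betw[OF bij_betw_matrix_of[OF \<pi>]])
  finally show ?thesis .
qed

lemma expectation_planted:
  assumes \<gamma>: "0 \<le> \<gamma>" "\<gamma> \<le> 1 / 2"
  shows "measure_pmf.expectation (planted n \<gamma>) f =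
         (\<Sum>\<pi>\<in>perms n. mean n \<gamma> \<pi> (\<lambda>T. f (T, \<pi>))) / fact n"
proof -
  let ?q = "map_pmf (\<lambda>b. if b then 1 else - 1 :: int) (bernoulli_pmf (1 / 2 + \<gamma>))"
  have ne: "perms n \<noteq> {}" using permutes_id[of "{..<n}"] by blast
  have fin: "finite (perms n)" by (simp add: finite_permutations)
  let ?f = "\<lambda>\<pi>. map_pmf (\<lambda>X. (matrix_of X, \<pi>)) (Pi_pmf (ordered_pairs n \<pi>) 0 (\<lambda>_. ?q))"
  have pl: "planted n \<gamma> = pmf_of_set (perms n) \<bind> ?f"
    unfolding planted_def map_pmf_def matrix_of_def by simp
  have "finite (set_pmf (Pi_pmf (ordered_pairs n \<pi>) 0 (\<lambda>_. ?q)))" for \<pi>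
    by (rule finite_subset[OF set_Pi_pmf_subset' finite_PiE_dflt]) auto
  then have "measure_pmf.expectation (planted n \<gamma>) f =
      (\<Sum>\<pi>\<in>perms n. measure_pmf.expectation (?f \<pi>) f /\<^sub>R real (card (perms n)))"
    unfolding pl by (intro pmf_expectation_bind_pmf_of_set ne fin) auto
  also have "\<dots> = (\<Sum>\<pi>\<in>perms n. mean n \<gamma> \<pi> (\<lambda>T. f (T, \<pi>)) / fact n)"
  proof (intro sum.cong refl)
    fix \<pi> assume "\<pi> \<in> perms n"
    then show "measure_pmf.expectation (?f \<pi>) f /\<^sub>R real (card (perms n)) =
        mean n \<gamma> \<pi> (\<lambda>T. f (T, \<pi>)) / fact n"
      using expectation_sign_pmf[of \<pi> n \<gamma> "\<lambda>T. f (T, \<pi>)"] \<gamma>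
      by (simp add: card_perms field_simps)
  qed
  finally show ?thesis by (simp add: sum_divide_distrib)
qed

section \<open>Relabelling of players and the pairing of permutations\<close>

abbreviation swap :: "nat \<Rightarrow> nat \<Rightarrow> nat \<Rightarrow> nat" where
  "swap \<equiv> Transposition.transpose"

definition relabel :: "(nat \<Rightarrow> nat) \<Rightarrow> matrix \<Rightarrow> matrix" where
  "relabel \<tau> T = (\<lambda>a b. T (\<tau> a) (\<tau> b))"

lemma relabel_tournament:
  assumes "\<tau> permutes {..<n}" "T \<in> tournaments n"
  shows "relabel \<tau> T \<in> tournaments n"
proof -
  have im: "\<tau> a < n \<longleftrightarrow> a < n" for a
    using permutes_in_image[OF assms(1)] by simp
  have inj: "\<tau> a = \<tau> b \<longleftrightarrow> a = b" for a b
    using permutes_inj[OF assms(1)] by (auto simp: inj_def)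
  have "T (\<tau> a) (\<tau> b) = - T (\<tau> b) (\<tau> a)" for a b
    by (rule tournament_antisym[OF assms(2)])
  moreover have "T (\<tau> a) (\<tau> b) \<in> {-1, 1}" if "a < n" "b < n" "a \<noteq> b" for a b
    using that by (intro tournament_sign[OF assms(2)]) (auto simp: im inj)
  moreover have "T (\<tau> a) (\<tau> b) = 0" if "\<not> (a < n \<and> b < n)" for a b
    using that by (intro tournament_outside[OF assms(2)]) (auto simp: im)
  ultimately show ?thesis
    unfolding tournaments_def tournament_def relabel_def mem_Collect_eq by blast
qed

lemma bij_betw_relabel:
  assumes "\<tau> permutes {..<n}"
  shows "bij_betw (relabel \<tau>) (tournaments n) (tournaments n)"
  using relabel_tournament[OF assms] relabel_tournament[OF permutes_inv[OF assms]]
    permutes_inverses[OF assms]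
  by (intro bij_betwI[where g = "relabel (inv \<tau>)"]) (auto simp: relabel_def)

lemma likelihood_relabel:
  assumes "\<tau> permutes {..<n}"
  shows "likelihood n \<gamma> (\<pi> \<circ> \<tau>) (relabel \<tau> T) = likelihood n \<gamma> \<pi> T"
proof -
  have im: "\<tau> a < n \<longleftrightarrow> a < n" "inv \<tau> a < n \<longleftrightarrow> a < n" for a
    using permutes_in_image[OF assms] permutes_in_image[OF permutes_inv[OF assms]] by auto
  have "bij_betw (map_prod \<tau> \<tau>) (ordered_pairs n (\<pi> \<circ> \<tau>)) (ordered_pairs n \<pi>)"
    by (rule bij_betwI[where g = "map_prod (inv \<tau>) (inv \<tau>)"])
      (auto simp: ordered_pairs_def permutes_inverses[OF assms] im)
  from prod.reindex_bij_betw[OF this, of "\<lambda>p. 1 / 2 + \<gamma> * T (fst p) (snd p)"] show ?thesis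
    by (simp add: likelihood_def relabel_def case_prod_unfold)
qed

text \<open>Turns an expectation under the exchanged permutation into one under
  \<open>\<pi>\<close>, which helps whenever the effect of a renaming on the statistic is known, as
  it is for scores.\<close>

lemma mean_relabel:
  assumes "\<tau> permutes {..<n}"
  shows "mean n \<gamma> (\<pi> \<circ> \<tau>) f = mean n \<gamma> \<pi> (\<lambda>T. f (relabel \<tau> T))"
  unfolding mean_def
  by (subst sum.reindex_bij_betw[OF bij_betw_relabel[OF assms], symmetric])
    (simp add: likelihood_relabel[OF assms])

text \<open>The involution sends \<open>(\<pi>, i, j)\<close> to
  \<open>(\<pi> \<circ> swap i j, j, i)\<close>: the names are exchanged along with the positions so
  that the pair stays ordered. Adding the sum to its image couples the two orders.\<close>

lemma sum_ordered_pairs_swap: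
  fixes L :: "(nat \<Rightarrow> nat) \<Rightarrow> nat \<Rightarrow> nat \<Rightarrow> real"
  shows "2 * (\<Sum>\<pi>\<in>perms n. \<Sum>(i, j)\<in>ordered_pairs n \<pi>. L \<pi> i j) =
         (\<Sum>\<pi>\<in>perms n. \<Sum>(i, j)\<in>ordered_pairs n \<pi>. L \<pi> i j + L (\<pi> \<circ> swap i j) j i)"
proof -
  let ?S = "Sigma (perms n) (ordered_pairs n)"
  let ?f = "\<lambda>(\<pi>, i, j). (\<pi> \<circ> swap i j, j, i) :: (nat \<Rightarrow> nat) \<times> nat \<times> nat"
  have fin: "finite (perms n)" by (simp add: finite_permutations)
  have perm: "\<pi> \<circ> swap i j permutes {..<n}"
    if "\<pi> permutes {..<n}" "(i, j) \<in> ordered_pairs n \<pi>" for \<pi> i j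
    using that by (intro permutes_compose permutes_swap_id) (auto simp: ordered_pairs_def)
  have invol: "?f (?f x) = x" for x
    by (cases x) (auto simp: transpose_commute comp_assoc)
  have closed: "?f x \<in> ?S" if "x \<in> ?S" for x
    using that perm by (auto simp: ordered_pairs_def)
  have bij: "bij_betw ?f ?S ?S"
    by (rule bij_betwI[where g = ?f]) (use invol closed in blast)+
  have "(\<Sum>(\<pi>, i, j)\<in>?S. L \<pi> i j) = (\<Sum>(\<pi>, i, j)\<in>?S. L (\<pi> \<circ> swap i j) j i)"
    by (subst sum.reindex_bij_betw[OF bij, symmetric]) (simp add: case_prod_unfold)
  moreover have sig: "(\<Sum>\<pi>\<in>perms n. \<Sum>(i, j)\<in>ordered_pairs n \<pi>. M \<pi> i j) =
      (\<Sum>(\<pi>, i, j)\<in>?S. M \<pi> i j)" for M :: "(nat \<Rightarrow> nat) \<Rightarrow> nat \<Rightarrow> nat \<Rightarrow> real"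
    by (subst sum.Sigma) (auto simp: fin)
  ultimately show ?thesis
    unfolding sig by (simp add: sum.distrib case_prod_unfold)
qed

lemma mean_sum: "mean n \<gamma> \<pi> (\<lambda>T. \<Sum>x\<in>A. f x T) = (\<Sum>x\<in>A. mean n \<gamma> \<pi> (f x))"
  unfolding mean_def by (simp add: sum_distrib_left sum.swap[of _ A])

lemma mean_add: "mean n \<gamma> \<pi> (\<lambda>T. f T + g T) = mean n \<gamma> \<pi> f + mean n \<gamma> \<pi> g"
  unfolding mean_def by (simp add: distrib_left sum.distrib)

lemma mean_diff: "mean n \<gamma> \<pi> (\<lambda>T. f T - g T) = mean n \<gamma> \<pi> f - mean n \<gamma> \<pi> g"
  unfolding mean_def by (simp add: right_diff_distrib sum_subtractf)

lemma mean_cmult: "mean n \<gamma> \<pi> (\<lambda>T. c * f T) = c * mean n \<gamma> \<pi> f"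
  unfolding mean_def by (simp add: sum_distrib_left mult_ac)

text \<open>Each summand is the sum of the two error probabilities of a test between
  \<open>\<pi>\<close> and \<open>\<pi> \<circ> swap i j\<close>. Both the lower and the upper
  bounds start from this identity.\<close>

lemma kendall_error:
  assumes "0 \<le> \<gamma> n" "\<gamma> n \<le> 1 / 2" "2 \<le> n"
  shows "2 * fact n * real (n choose 2) * recovery_error \<gamma> A n =
    (\<Sum>\<pi>\<in>perms n. \<Sum>(i, j)\<in>ordered_pairs n \<pi>.
       mean n (\<gamma> n) \<pi> (\<lambda>T. of_bool (A n T j < A n T i)) +
       mean n (\<gamma> n) (\<pi> \<circ> swap i j) (\<lambda>T. of_bool (A n T i < A n T j)))"
proof -
  have pos: "real (n choose 2) \<noteq> 0" using assms(3) by simp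
  have "recovery_error \<gamma> A n * real (n choose 2) =
      (\<Sum>\<pi>\<in>perms n. mean n (\<gamma> n) \<pi> (\<lambda>T. kendall_tau n \<pi> (A n T))) / fact n"
    using pos by (simp add: recovery_error_def expectation_planted[OF assms(1,2)])
  then have "fact n * real (n choose 2) * recovery_error \<gamma> A n =
      (\<Sum>\<pi>\<in>perms n. mean n (\<gamma> n) \<pi> (\<lambda>T. kendall_tau n \<pi> (A n T)))"
    by (simp add: field_simps)
  also have "\<dots> = (\<Sum>\<pi>\<in>perms n. \<Sum>(i, j)\<in>ordered_pairs n \<pi>.
      mean n (\<gamma> n) \<pi> (\<lambda>T. of_bool (A n T j < A n T i)))"
    by (simp only: kendall_tau_def case_prod_unfold of_nat_sum of_nat_of_bool mean_sum)
  finally show ?thesis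
    by (simp only: mult.assoc sum_ordered_pairs_swap)
qed

text \<open>Change of variables from players to positions, after which the sum no longer depends on
  \<open>\<pi>\<close>.\<close>

lemma sum_ordered_pairs:
  fixes \<phi> :: "nat \<Rightarrow> nat \<Rightarrow> 'a::comm_monoid_add"
  assumes "\<pi> permutes {..<n}"
  shows "(\<Sum>(i, j)\<in>ordered_pairs n \<pi>. \<phi> (\<pi> i) (\<pi> j)) = (\<Sum>b<n. \<Sum>a<b. \<phi> a b)"
proof -
  have im: "\<pi> a < n \<longleftrightarrow> a < n" "inv \<pi> a < n \<longleftrightarrow> a < n" for a
    using permutes_in_image[OF assms] permutes_in_image[OF permutes_inv[OF assms]] by auto
  have "(\<Sum>b<n. \<Sum>a<b. \<phi> a b) = (\<Sum>(b, a)\<in>(SIGMA b:{..<n}. {..<b}). \<phi> a b)"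
    by (rule sum.Sigma) auto
  also have "\<dots> = (\<Sum>(i, j)\<in>ordered_pairs n \<pi>. \<phi> (\<pi> i) (\<pi> j))"
    by (rule sum.reindex_bij_witness[where i = "\<lambda>(i, j). (\<pi> j, \<pi> i)"
          and j = "\<lambda>(b, a). (inv \<pi> a, inv \<pi> b)"])
      (auto simp: ordered_pairs_def im permutes_inverses[OF assms])
  finally show ?thesis ..
qed

lemma card_ordered_pairs:
  assumes "\<pi> permutes {..<n}"
  shows "card (ordered_pairs n \<pi>) = n choose 2"
proof -
  have "card (ordered_pairs n \<pi>) = (\<Sum>b<n. \<Sum>a<b. 1)"
    using sum_ordered_pairs[OF assms, of "\<lambda>_ _. 1::nat"] by (simp add: case_prod_unfold)
  also have "\<dots> = n choose 2"
    by (induction n) (auto simp: numeral_2_eq_2)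
  finally show ?thesis .
qed

section \<open>Independence of the matches and the first two moments of linear statistics\<close>

lemma mean_prod:
  assumes "\<pi> permutes {..<n}"
  shows "mean n \<gamma> \<pi> (\<lambda>T. \<Prod>p\<in>ordered_pairs n \<pi>. g p (T (fst p) (snd p))) =
    (\<Prod>p\<in>ordered_pairs n \<pi>. (1 / 2 + \<gamma>) * g p 1 + (1 / 2 - \<gamma>) * g p (-1))"
  using sum_tournaments_prod[OF assms, of "\<lambda>p x. (1 / 2 + \<gamma> * x) * g p x"]
  by (simp add: mean_def likelihood_def case_prod_unfold prod.distrib)

lemma sum_likelihood:
  assumes "\<pi> permutes {..<n}"
  shows "(\<Sum>T\<in>tournaments n. likelihood n \<gamma> \<pi> T) = 1"
  using mean_prod[OF assms, of \<gamma> "\<lambda>_ _. 1"] by (simp add: mean_def)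

lemma mean_const:
  assumes "\<pi> permutes {..<n}"
  shows "mean n \<gamma> \<pi> (\<lambda>_. c) = c"
  using sum_likelihood[OF assms] by (simp add: mean_def flip: sum_distrib_right)

lemma likelihood_nonneg:
  assumes "0 \<le> \<gamma>" "\<gamma> \<le> 1 / 2" "T \<in> tournaments n"
  shows "0 \<le> likelihood n \<gamma> \<pi> T"
  unfolding likelihood_def
proof (intro prod_nonneg, clarify)
  fix a b assume "(a, b) \<in> ordered_pairs n \<pi>"
  with tournament_sign_ordered[OF assms(3) this] assms(1,2) show "0 \<le> 1 / 2 + \<gamma> * T a b"
    by auto
qed

lemma mean_mono:
  assumes "0 \<le> \<gamma>" "\<gamma> \<le> 1 / 2" "\<And>T. T \<in> tournaments n \<Longrightarrow> f T \<le> g T"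
  shows "mean n \<gamma> \<pi> f \<le> mean n \<gamma> \<pi> g"
  unfolding mean_def using assms likelihood_nonneg
  by (intro sum_mono mult_left_mono) auto

lemma mean_square:
  assumes \<pi>: "\<pi> permutes {..<n}"
  shows "mean n \<gamma> \<pi> (\<lambda>T. (f T)\<^sup>2) =
    (mean n \<gamma> \<pi> f)\<^sup>2 + mean n \<gamma> \<pi> (\<lambda>T. (f T - mean n \<gamma> \<pi> f)\<^sup>2)"
proof -
  define m where "m = mean n \<gamma> \<pi> f"
  have "mean n \<gamma> \<pi> (\<lambda>T. (f T - m)\<^sup>2) = mean n \<gamma> \<pi> (\<lambda>T. (f T)\<^sup>2 - (2 * m) * f T + m\<^sup>2)"
    by (simp add: power2_diff algebra_simps)
  also have "\<dots> = mean n \<gamma> \<pi> (\<lambda>T. (f T)\<^sup>2) - (2 * m) * m + m\<^sup>2"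
    unfolding mean_add mean_diff mean_cmult mean_const[OF \<pi>] by (simp add: m_def)
  finally show ?thesis by (simp add: m_def power2_eq_square)
qed

lemma mean_sq_le:
  assumes "0 \<le> \<gamma>" "\<gamma> \<le> 1 / 2" and \<pi>: "\<pi> permutes {..<n}"
  shows "(mean n \<gamma> \<pi> f)\<^sup>2 \<le> mean n \<gamma> \<pi> (\<lambda>T. (f T)\<^sup>2)"
proof -
  have "mean n \<gamma> \<pi> (\<lambda>_. 0) \<le> mean n \<gamma> \<pi> (\<lambda>T. (f T - mean n \<gamma> \<pi> f)\<^sup>2)"
    using assms by (intro mean_mono) auto
  then show ?thesis by (simp add: mean_square[OF \<pi>, of \<gamma> f] mean_const[OF \<pi>])
qed

lemma mean_linear:
  fixes c :: "nat \<times> nat \<Rightarrow> real"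
  assumes \<pi>: "\<pi> permutes {..<n}"
  shows "mean n \<gamma> \<pi> (\<lambda>T. \<Sum>p\<in>ordered_pairs n \<pi>. c p * T (fst p) (snd p)) =
         2 * \<gamma> * (\<Sum>p\<in>ordered_pairs n \<pi>. c p)"
proof -
  let ?P = "ordered_pairs n \<pi>"
  have 1: "mean n \<gamma> \<pi> (\<lambda>T. T (fst p) (snd p)) = 2 * \<gamma>" if p: "p \<in> ?P" for p
  proof -
    have "mean n \<gamma> \<pi> (\<lambda>T. real_of_int (T (fst p) (snd p))) =
        mean n \<gamma> \<pi> (\<lambda>T. \<Prod>r\<in>?P. if r = p then real_of_int (T (fst r) (snd r)) else 1)"
      using p by simp
    also have "\<dots> = (\<Prod>r\<in>?P. if r = p then 2 * \<gamma> else 1)"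
      by (subst mean_prod[OF \<pi>, of \<gamma> "\<lambda>r x. if r = p then real_of_int x else 1"])
        (rule prod.cong, simp_all)
    finally show ?thesis using p by simp
  qed
  show ?thesis
    by (simp add: mean_sum mean_cmult 1 sum_distrib_left mult_ac)
qed

lemma mean_linear_centered_sq:
  fixes c :: "nat \<times> nat \<Rightarrow> real"
  assumes \<pi>: "\<pi> permutes {..<n}"
  shows "mean n \<gamma> \<pi> (\<lambda>T. (\<Sum>p\<in>ordered_pairs n \<pi>. c p * (T (fst p) (snd p) - 2 * \<gamma>))\<^sup>2) =
         (1 - 4 * \<gamma>\<^sup>2) * (\<Sum>p\<in>ordered_pairs n \<pi>. (c p)\<^sup>2)"
proof -
  let ?P = "ordered_pairs n \<pi>"
  let ?u = "\<lambda>p T. real_of_int (T (fst p) (snd p)) - 2 * \<gamma>"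
  have 2: "mean n \<gamma> \<pi> (\<lambda>T. ?u p T * ?u q T) = (if p = q then 1 - 4 * \<gamma>\<^sup>2 else 0)"
    if p: "p \<in> ?P" and q: "q \<in> ?P" for p q
  proof -
    \<comment> \<open>The two conditional factors meet in one coordinate exactly if
      \<open>p = q\<close>; otherwise a centred factor stands alone and has mean
      \<open>0\<close>.\<close>
    have "mean n \<gamma> \<pi> (\<lambda>T. ?u p T * ?u q T) =
        mean n \<gamma> \<pi> (\<lambda>T. \<Prod>r\<in>?P. (if r = p then ?u r T else 1) * (if r = q then ?u r T else 1))"
      using p q by (simp add: prod.distrib)
    also have "\<dots> = (\<Prod>r\<in>?P. if r = p \<and> r = q then 1 - 4 * \<gamma>\<^sup>2 else if r = p \<or> r = q then 0 else 1)"
      by (subst mean_prod[OF \<pi>, of \<gamma> "\<lambda>r x. (if r = p then real_of_int x - 2 * \<gamma> else 1) *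
            (if r = q then real_of_int x - 2 * \<gamma> else 1)"])
        (rule prod.cong, auto simp: field_simps power2_eq_square)
    also have "\<dots> = (if p = q then 1 - 4 * \<gamma>\<^sup>2 else 0)"
    proof (cases "p = q")
      case True
      with q show ?thesis by (simp cong: if_cong)
    next
      case False
      with p show ?thesis by (auto intro!: prod_zero bexI[of _ p])
    qed
    finally show ?thesis .
  qed
  have "mean n \<gamma> \<pi> (\<lambda>T. (\<Sum>p\<in>?P. c p * ?u p T)\<^sup>2) =
      mean n \<gamma> \<pi> (\<lambda>T. \<Sum>p\<in>?P. \<Sum>q\<in>?P. (c p * c q) * (?u p T * ?u q T))"
    by (simp add: power2_eq_square sum_product mult_ac)
  also have "\<dots> = (\<Sum>p\<in>?P. \<Sum>q\<in>?P. (c p * c q) * (if p = q then 1 - 4 * \<gamma>\<^sup>2 else 0))"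
    unfolding mean_sum mean_cmult by (intro sum.cong refl) (simp add: 2)
  also have "\<dots> = (\<Sum>p\<in>?P. (c p)\<^sup>2 * (1 - 4 * \<gamma>\<^sup>2))"
    by (intro sum.cong refl) (simp add: if_distrib power2_eq_square cong: if_cong)
  finally show ?thesis by (simp add: sum_distrib_left sum_distrib_right mult_ac)
qed

section \<open>Impossibility of recovery\<close>

text \<open>Brings both likelihoods to the index set of \<open>\<pi>\<close>, so that they can be
  multiplied factor by factor. A pair in the opposite order in \<open>\<rho>\<close> is replaced by
  its reversal, which changes the sign of the entry.\<close>

lemma likelihood_other:
  assumes "\<pi> permutes {..<n}" "\<rho> permutes {..<n}" "T \<in> tournaments n"
  shows "likelihood n \<gamma> \<rho> T = (\<Prod>p\<in>ordered_pairs n \<pi>.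
    if p \<in> ordered_pairs n \<rho> then 1 / 2 + \<gamma> * T (fst p) (snd p) else 1 / 2 - \<gamma> * T (fst p) (snd p))"
proof -
  let ?P = "ordered_pairs n \<pi>" and ?R = "ordered_pairs n \<rho>"
  let ?g = "\<lambda>p. if p \<in> ?R then p else (snd p, fst p)"
  have T: "T a b = - T b a" for a b
    by (rule tournament_antisym[OF assms(3)])
  have mem: "(b, a) \<in> ordered_pairs n \<sigma>"
    if "\<sigma> permutes {..<n}" "(a, b) \<notin> ordered_pairs n \<sigma>" "a < n" "b < n" "a \<noteq> b" for \<sigma> a b
    using ordered_pairs_total[of \<sigma> n a b] that by blast
  have dom: "a < n \<and> b < n \<and> a \<noteq> b" if "(a, b) \<in> ordered_pairs n \<sigma>" for a b \<sigma>
    using that by (auto simp: ordered_pairs_def)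
  have bij: "bij_betw ?g ?P ?R"
  proof (rule bij_betwI[where g = "\<lambda>p. if p \<in> ?P then p else (snd p, fst p)"])
    show "?g \<in> ?P \<rightarrow> ?R" using mem[OF assms(2)] dom by fastforce
    show "(\<lambda>p. if p \<in> ?P then p else (snd p, fst p)) \<in> ?R \<rightarrow> ?P"
      using mem[OF assms(1)] dom by fastforce
  qed (use ordered_pairs_asym in fastforce)+
  have "likelihood n \<gamma> \<rho> T = (\<Prod>p\<in>?R. 1 / 2 + \<gamma> * T (fst p) (snd p))"
    by (simp add: likelihood_def case_prod_unfold)
  also have "\<dots> = (\<Prod>p\<in>?P. 1 / 2 + \<gamma> * T (fst (?g p)) (snd (?g p)))"
    by (rule prod.reindex_bij_betw[OF bij, symmetric])
  also have "\<dots> = (\<Prod>p\<in>?P. if p \<in> ?R then 1 / 2 + \<gamma> * T (fst p) (snd p)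
      else 1 / 2 - \<gamma> * T (fst p) (snd p))"
  proof (intro prod.cong refl)
    fix p
    show "1 / 2 + \<gamma> * T (fst (?g p)) (snd (?g p)) = (if p \<in> ?R
      then 1 / 2 + \<gamma> * T (fst p) (snd p) else 1 / 2 - \<gamma> * T (fst p) (snd p))"
      using T[of "fst p" "snd p"] by auto
  qed
  finally show ?thesis .
qed

lemma sqrt_prod: "finite A \<Longrightarrow> sqrt (\<Prod>x\<in>A. f x) = (\<Prod>x\<in>A. sqrt (f x))"
  by (induction A rule: finite_induct) (auto simp: real_sqrt_mult)

text \<open>The Bhattacharyya coefficient factorises. A pair ordered alike by both permutations
  contributes \<open>1\<close>; a pair ordered oppositely contributes
  \<open>sqrt ((1 / 2 + \<gamma>) * (1 / 2 - \<gamma>))\<close> for either sign, hence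
  \<open>sqrt (1 - 4 * \<gamma>\<^sup>2)\<close> in total.\<close>

lemma sum_sqrt_likelihood:
  assumes "\<pi> permutes {..<n}" "\<rho> permutes {..<n}" and \<gamma>: "0 \<le> \<gamma>" "\<gamma> \<le> 1 / 2"
  shows "(\<Sum>T\<in>tournaments n. sqrt (likelihood n \<gamma> \<pi> T * likelihood n \<gamma> \<rho> T)) =
    sqrt (1 - 4 * \<gamma>\<^sup>2) ^ card (ordered_pairs n \<pi> - ordered_pairs n \<rho>)"
proof -
  let ?P = "ordered_pairs n \<pi>" and ?R = "ordered_pairs n \<rho>"
  define g :: "nat \<times> nat \<Rightarrow> int \<Rightarrow> real" where
    "g p x = (if p \<in> ?R then 1 / 2 + \<gamma> * x else sqrt (1 / 4 - \<gamma>\<^sup>2))" for p x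
  have "sqrt (likelihood n \<gamma> \<pi> T * likelihood n \<gamma> \<rho> T) = (\<Prod>p\<in>?P. g p (T (fst p) (snd p)))"
    if T: "T \<in> tournaments n" for T
  proof -
    have "likelihood n \<gamma> \<pi> T * likelihood n \<gamma> \<rho> T = (\<Prod>p\<in>?P. (g p (T (fst p) (snd p)))\<^sup>2)"
      unfolding likelihood_other[OF assms(1,2) T] likelihood_def[of n \<gamma> \<pi>]
        prod.distrib[symmetric] case_prod_unfold
    proof (intro prod.cong refl)
      fix p assume "p \<in> ?P"
      note t = tournament_sign_ordered[OF T this]
      have "\<gamma>\<^sup>2 \<le> (1 / 2)\<^sup>2" using \<gamma> by (intro power_mono) auto
      then have "(sqrt (1 / 4 - \<gamma>\<^sup>2))\<^sup>2 = 1 / 4 - \<gamma>\<^sup>2" by (simp add: power2_eq_square)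
      with t show "(1 / 2 + \<gamma> * T (fst p) (snd p)) * (if p \<in> ?R then 1 / 2 + \<gamma> * T (fst p) (snd p)
          else 1 / 2 - \<gamma> * T (fst p) (snd p)) = (g p (T (fst p) (snd p)))\<^sup>2"
        by (cases "p \<in> ?R") (auto simp: g_def power2_eq_square field_simps simp del: real_sqrt_mult_self)
    qed
    moreover have "0 \<le> g p (T (fst p) (snd p))" if "p \<in> ?P" for p
    proof -
      note t = tournament_sign_ordered[OF T that]
      have "\<gamma>\<^sup>2 \<le> (1 / 2)\<^sup>2" using \<gamma> by (intro power_mono) auto
      with t \<gamma> show ?thesis by (auto simp: g_def power2_eq_square)
    qed
    ultimately show ?thesis by (simp add: sqrt_prod)
  qed
  then have "(\<Sum>T\<in>tournaments n. sqrt (likelihood n \<gamma> \<pi> T * likelihood n \<gamma> \<rho> T)) =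
      (\<Sum>T\<in>tournaments n. \<Prod>p\<in>?P. g p (T (fst p) (snd p)))" by simp
  also have "\<dots> = (\<Prod>p\<in>?P. g p 1 + g p (-1))"
    by (rule sum_tournaments_prod[OF assms(1)])
  also have "\<dots> = (\<Prod>p\<in>?P. if p \<in> ?R then 1 else sqrt (1 - 4 * \<gamma>\<^sup>2))"
  proof (intro prod.cong refl)
    fix p
    have "sqrt (1 - 4 * \<gamma>\<^sup>2) = sqrt (4 * (1 / 4 - \<gamma>\<^sup>2))" by simp
    also have "\<dots> = 2 * sqrt (1 / 4 - \<gamma>\<^sup>2)" by (subst real_sqrt_mult) simp
    finally show "g p 1 + g p (-1) = (if p \<in> ?R then 1 else sqrt (1 - 4 * \<gamma>\<^sup>2))"
      by (simp add: g_def)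
  qed
  also have "\<dots> = sqrt (1 - 4 * \<gamma>\<^sup>2) ^ card (?P - ?R)"
    by (simp add: prod.If_cases Diff_eq)
  finally show ?thesis .
qed

text \<open>Le Cam's inequality. If the minima sum to \<open>m\<close>, the maxima sum to
  \<open>2 - m\<close>, and \<open>f x * g x\<close> is the product of minimum and maximum;
  Cauchy--Schwarz bounds the squared coefficient by
  \<open>m * (2 - m) = 1 - (1 - m)\<^sup>2\<close>.\<close>

lemma sum_min_ge:
  fixes f g :: "'a \<Rightarrow> real"
  assumes "finite A" "\<And>x. x \<in> A \<Longrightarrow> 0 \<le> f x" "\<And>x. x \<in> A \<Longrightarrow> 0 \<le> g x"
    and "sum f A = 1" "sum g A = 1"
  shows "1 - sqrt (1 - (\<Sum>x\<in>A. sqrt (f x * g x))\<^sup>2) \<le> (\<Sum>x\<in>A. min (f x) (g x))"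
proof -
  define m where "m = (\<Sum>x\<in>A. min (f x) (g x))"
  have "(\<Sum>x\<in>A. max (f x) (g x)) + m = sum f A + sum g A"
    unfolding m_def sum.distrib[symmetric] by (intro sum.cong refl) auto
  then have M: "(\<Sum>x\<in>A. max (f x) (g x)) = 2 - m" using assms by simp
  have m1: "m \<le> 1"
    unfolding m_def assms(4)[symmetric] by (intro sum_mono) auto
  have "(\<Sum>x\<in>A. sqrt (f x * g x)) =
      (\<Sum>x\<in>A. sqrt (min (f x) (g x)) * sqrt (max (f x) (g x)))"
    by (intro sum.cong refl) (auto simp: min_def max_def real_sqrt_mult)
  then have "(\<Sum>x\<in>A. sqrt (f x * g x))\<^sup>2 \<le>
      (\<Sum>x\<in>A. (sqrt (min (f x) (g x)))\<^sup>2) * (\<Sum>x\<in>A. (sqrt (max (f x) (g x)))\<^sup>2)"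
    using Cauchy_Schwarz_ineq_sum by metis
  also have "\<dots> = m * (2 - m)"
  proof -
    have "(\<Sum>x\<in>A. (sqrt (min (f x) (g x)))\<^sup>2) = m"
      unfolding m_def using assms by (intro sum.cong refl real_sqrt_pow2) simp
    moreover have "(\<Sum>x\<in>A. (sqrt (max (f x) (g x)))\<^sup>2) = 2 - m"
      unfolding M[symmetric] using assms by (intro sum.cong refl real_sqrt_pow2) (simp add: max_def)
    ultimately show ?thesis by simp
  qed
  finally have "(1 - m)\<^sup>2 \<le> 1 - (\<Sum>x\<in>A. sqrt (f x * g x))\<^sup>2"
    by (simp add: power2_eq_square algebra_simps)
  then have "1 - m \<le> sqrt (1 - (\<Sum>x\<in>A. sqrt (f x * g x))\<^sup>2)"
    by (rule real_le_rsqrt)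
  then show ?thesis by (simp add: m_def)
qed

text \<open>Only pairs that contain \<open>i\<close> or \<open>j\<close> can change their order. The
  count is crude; any linear bound would serve.\<close>

lemma card_ordered_pairs_swap:
  "card (ordered_pairs n \<pi> - ordered_pairs n (\<pi> \<circ> swap i j)) \<le> 4 * n"
proof -
  have "card (ordered_pairs n \<pi> - ordered_pairs n (\<pi> \<circ> swap i j)) \<le>
      card ({i, j} \<times> {..<n} \<union> {..<n} \<times> {i, j})"
    by (rule card_mono) (auto simp: ordered_pairs_def Transposition.transpose_def)
  also have "\<dots> \<le> card ({i, j} \<times> {..<n}) + card ({..<n} \<times> {i, j})"
    by (rule card_Un_le)
  also have "\<dots> \<le> 2 * n + n * 2"
    unfolding card_cartesian_product by (intro add_mono mult_mono) (auto simp: card_insert_if)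
  finally show ?thesis by simp
qed

lemma recovery_error_ge:
  assumes A: "algorithm A" and \<gamma>: "0 \<le> \<gamma> n" "\<gamma> n \<le> 1 / 2" and n: "2 \<le> n"
  shows "(1 - sqrt (1 - (1 - 4 * (\<gamma> n)\<^sup>2) ^ (4 * n))) / 2 \<le> recovery_error \<gamma> A n"
proof -
  let ?c = "1 - sqrt (1 - (1 - 4 * (\<gamma> n)\<^sup>2) ^ (4 * n))"
  have "(\<gamma> n)\<^sup>2 \<le> (1 / 2)\<^sup>2" using \<gamma> by (intro power_mono) auto
  then have b: "0 \<le> 1 - 4 * (\<gamma> n)\<^sup>2" "1 - 4 * (\<gamma> n)\<^sup>2 \<le> 1" by (auto simp: power2_eq_square)
  have pair: "?c \<le> mean n (\<gamma> n) \<pi> (\<lambda>T. of_bool (A n T j < A n T i)) +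
       mean n (\<gamma> n) (\<pi> \<circ> swap i j) (\<lambda>T. of_bool (A n T i < A n T j))"
    if \<pi>: "\<pi> permutes {..<n}" and ij: "(i, j) \<in> ordered_pairs n \<pi>" for \<pi> i j
  proof -
    let ?\<rho> = "\<pi> \<circ> swap i j"
    let ?w = "likelihood n (\<gamma> n) \<pi>" and ?v = "likelihood n (\<gamma> n) ?\<rho>"
    have \<rho>: "?\<rho> permutes {..<n}"
      using ij by (intro permutes_compose permutes_swap_id \<pi>) (auto simp: ordered_pairs_def)
    note nn = likelihood_nonneg[OF \<gamma>]
    have "(1 - 4 * (\<gamma> n)\<^sup>2) ^ (4 * n) \<le>
        (1 - 4 * (\<gamma> n)\<^sup>2) ^ card (ordered_pairs n \<pi> - ordered_pairs n ?\<rho>)"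
      by (intro power_decreasing card_ordered_pairs_swap b)
    also have "\<dots> = (\<Sum>T\<in>tournaments n. sqrt (?w T * ?v T))\<^sup>2"
      unfolding sum_sqrt_likelihood[OF \<pi> \<rho> \<gamma>] using b
      by (simp add: power_mult[symmetric] mult.commute[of _ 2]) (simp add: power_mult)
    finally have "?c \<le> 1 - sqrt (1 - (\<Sum>T\<in>tournaments n. sqrt (?w T * ?v T))\<^sup>2)"
      by simp
    also have "\<dots> \<le> (\<Sum>T\<in>tournaments n. min (?w T) (?v T))"
      by (rule sum_min_ge) (auto simp: nn sum_likelihood[OF \<pi>] sum_likelihood[OF \<rho>])
    \<comment> \<open>For every \<open>T\<close> the output puts \<open>i\<close> and
      \<open>j\<close> in one of the two orders and is therefore wrong under one of the two laws;
      injectivity of the output excludes ties.\<close>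
    also have "\<dots> \<le> (\<Sum>T\<in>tournaments n. ?w T * of_bool (A n T j < A n T i) +
        ?v T * of_bool (A n T i < A n T j))"
    proof (rule sum_mono)
      fix T assume T: "T \<in> tournaments n"
      then have "A n T permutes {..<n}"
        using A by (auto simp: algorithm_def tournaments_def)
      moreover have "i \<noteq> j" using ij by (auto simp: ordered_pairs_def)
      ultimately have "A n T i \<noteq> A n T j"
        using permutes_inj by (auto simp: inj_def)
      then show "min (?w T) (?v T) \<le> ?w T * of_bool (A n T j < A n T i) +
          ?v T * of_bool (A n T i < A n T j)"
        by (cases "A n T i < A n T j") auto
    qed
    also have "\<dots> = mean n (\<gamma> n) \<pi> (\<lambda>T. of_bool (A n T j < A n T i)) +
       mean n (\<gamma> n) ?\<rho> (\<lambda>T. of_bool (A n T i < A n T j))"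
      by (simp add: mean_def sum.distrib)
    finally show ?thesis .
  qed
  have "fact n * real (n choose 2) * ?c = (\<Sum>\<pi>\<in>perms n. \<Sum>(i, j)\<in>ordered_pairs n \<pi>. ?c)"
    by (simp add: case_prod_unfold card_ordered_pairs card_perms)
  also have "\<dots> \<le> 2 * fact n * real (n choose 2) * recovery_error \<gamma> A n"
    unfolding kendall_error[of \<gamma>, OF \<gamma> n] using pair by (intro sum_mono) auto
  finally have "(fact n * real (n choose 2)) * ?c \<le>
      (fact n * real (n choose 2)) * (2 * recovery_error \<gamma> A n)" by simp
  moreover have "0 < fact n * real (n choose 2)" using n by simp
  ultimately have "?c \<le> 2 * recovery_error \<gamma> A n" using mult_le_cancel_left_pos by blast
  then show ?thesis by simp
qed

lemma no_strong_recovery: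
  assumes \<gamma>: "\<And>n. 0 \<le> \<gamma> n" "\<And>n. \<gamma> n \<le> 1 / 4"
    and O: "\<gamma> \<in> O(\<lambda>n. real n powr (- 1 / 2))" and A: "algorithm A"
  shows "\<not> strong_recovery \<gamma> A"
proof
  assume "strong_recovery \<gamma> A"
  then have lim: "recovery_error \<gamma> A \<longlonglongrightarrow> 0" by (simp add: strong_recovery_def)
  from O obtain c where c: "c > 0" "\<forall>\<^sub>F n in sequentially. norm (\<gamma> n) \<le> c * norm (real n powr (- 1 / 2))"
    by (elim landau_o.bigE)
  \<comment> \<open>The constant \<open>32 = 8 * 4\<close> comes from
    \<open>1 - x \<ge> exp (- 2 * x)\<close> at \<open>x = 4 * \<gamma>\<^sup>2\<close>, raised to
    the power \<open>4 * n\<close>, with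
    \<open>\<gamma>\<^sup>2 * n \<le> c\<^sup>2\<close>.\<close>
  define e where "e = (1 - sqrt (1 - exp (- (32 * c\<^sup>2)))) / 2"
  have e: "0 < e" by (simp add: e_def)
  have "\<forall>\<^sub>F n in sequentially. e \<le> recovery_error \<gamma> A n"
    using c(2) eventually_ge_at_top[of 2]
  proof eventually_elim
    case (elim n)
    have "(\<gamma> n)\<^sup>2 \<le> (c * real n powr (- 1 / 2))\<^sup>2"
      using elim(1) \<gamma>(1)[of n] by (intro power_mono) auto
    also have "\<dots> = c\<^sup>2 / n"
      using elim(2) by (simp add: power_mult_distrib powr_minus powr_half_sqrt field_simps)
    finally have g: "(\<gamma> n)\<^sup>2 * n \<le> c\<^sup>2" using elim(2) by (simp add: field_simps)
    have "(\<gamma> n)\<^sup>2 \<le> (1 / 4)\<^sup>2" using \<gamma> by (intro power_mono) auto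
    then have q: "4 * (\<gamma> n)\<^sup>2 \<le> 1 / 4" by (simp add: power2_eq_square)
    have "exp (- (8 * (\<gamma> n)\<^sup>2)) \<le> 1 - 4 * (\<gamma> n)\<^sup>2"
    proof -
      have "- (4 * (\<gamma> n)\<^sup>2) - 2 * (4 * (\<gamma> n)\<^sup>2)\<^sup>2 \<le> ln (1 - 4 * (\<gamma> n)\<^sup>2)"
        using q by (intro ln_one_minus_pos_lower_bound) auto
      moreover have "(4 * (\<gamma> n)\<^sup>2)\<^sup>2 \<le> (4 * (\<gamma> n)\<^sup>2) * (1 / 4)"
        unfolding power2_eq_square[of "4 * _"] using q by (intro mult_left_mono) auto
      ultimately have "- (8 * (\<gamma> n)\<^sup>2) \<le> ln (1 - 4 * (\<gamma> n)\<^sup>2)"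
        using zero_le_power2[of "\<gamma> n"] by linarith
      then show ?thesis using q by (subst (asm) ln_ge_iff) auto
    qed
    then have "exp (- (8 * (\<gamma> n)\<^sup>2)) ^ (4 * n) \<le> (1 - 4 * (\<gamma> n)\<^sup>2) ^ (4 * n)"
      by (intro power_mono) auto
    moreover have "exp (- (8 * (\<gamma> n)\<^sup>2)) ^ (4 * n) = exp (- (32 * ((\<gamma> n)\<^sup>2 * n)))"
      by (simp flip: exp_of_nat_mult)
    moreover have "exp (- (32 * c\<^sup>2)) \<le> exp (- (32 * ((\<gamma> n)\<^sup>2 * n)))" using g by simp
    ultimately have "exp (- (32 * c\<^sup>2)) \<le> (1 - 4 * (\<gamma> n)\<^sup>2) ^ (4 * n)" by linarith
    then have "e \<le> (1 - sqrt (1 - (1 - 4 * (\<gamma> n)\<^sup>2) ^ (4 * n))) / 2"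
      by (simp add: e_def)
    also have "\<dots> \<le> recovery_error \<gamma> A n"
      using \<gamma>(2)[of n] by (intro recovery_error_ge A \<gamma> elim) auto
    finally show ?case .
  qed
  from tendsto_lowerbound[OF lim this] e show False by simp
qed

lemma no_weak_recovery:
  assumes \<gamma>: "\<And>n. 0 \<le> \<gamma> n" "\<And>n. \<gamma> n \<le> 1 / 4"
    and o: "\<gamma> \<in> o(\<lambda>n. real n powr (- 1 / 2))" and A: "algorithm A"
  shows "\<not> weak_recovery \<gamma> A"
proof
  assume "weak_recovery \<gamma> A"
  then obtain \<delta> where \<delta>: "\<delta> > 0" "limsup (\<lambda>n. ereal (recovery_error \<gamma> A n)) \<le> ereal (1 / 2 - \<delta>)"
    by (auto simp: weak_recovery_def)
  \<comment> \<open>This constant gives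
    \<open>16 * \<gamma>\<^sup>2 * n \<le> \<delta>\<^sup>2\<close>, and
    \<open>4 * n * (4 * \<gamma>\<^sup>2)\<close> is what Bernoulli's inequality loses. The error is
    then at least \<open>1 / 2 - \<delta> / 2\<close>, above the permitted
    \<open>1 / 2 - \<delta>\<close>.\<close>
  from \<delta>(1) have "0 < \<delta> / 4" by simp
  from landau_o.smallD[OF o this]
  have "\<forall>\<^sub>F n in sequentially. norm (\<gamma> n) \<le> \<delta> / 4 * norm (real n powr (- 1 / 2))" .
  then have "\<forall>\<^sub>F n in sequentially. 1 / 2 - \<delta> / 2 \<le> recovery_error \<gamma> A n"
    using eventually_ge_at_top[of 2]
  proof eventually_elim
    case (elim n)
    have "(\<gamma> n)\<^sup>2 \<le> (\<delta> / 4 * real n powr (- 1 / 2))\<^sup>2"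
      using elim(1) \<gamma>(1)[of n] by (intro power_mono) auto
    also have "\<dots> = (\<delta> / 4)\<^sup>2 / n"
      using elim(2) by (simp add: power_mult_distrib powr_minus powr_half_sqrt field_simps)
    finally have g: "16 * ((\<gamma> n)\<^sup>2 * n) \<le> \<delta>\<^sup>2"
      using elim(2) by (simp add: field_simps power2_eq_square)
    have "(\<gamma> n)\<^sup>2 \<le> (1 / 4)\<^sup>2" using \<gamma> by (intro power_mono) auto
    then have q: "4 * (\<gamma> n)\<^sup>2 \<le> 1 / 4" by (simp add: power2_eq_square)
    have "1 + real (4 * n) * (- (4 * (\<gamma> n)\<^sup>2)) \<le> (1 + - (4 * (\<gamma> n)\<^sup>2)) ^ (4 * n)"
      using q by (intro Bernoulli_inequality) auto
    then have "1 - (1 - 4 * (\<gamma> n)\<^sup>2) ^ (4 * n) \<le> \<delta>\<^sup>2"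
      using g by (simp add: algebra_simps)
    then have "sqrt (1 - (1 - 4 * (\<gamma> n)\<^sup>2) ^ (4 * n)) \<le> \<delta>"
      using \<delta>(1) by (intro real_le_lsqrt) auto
    then have "1 / 2 - \<delta> / 2 \<le> (1 - sqrt (1 - (1 - 4 * (\<gamma> n)\<^sup>2) ^ (4 * n))) / 2"
      by simp
    also have "\<dots> \<le> recovery_error \<gamma> A n"
      using \<gamma>(2)[of n] by (intro recovery_error_ge A \<gamma> elim) auto
    finally show ?case .
  qed
  then have "ereal (1 / 2 - \<delta> / 2) \<le> limsup (\<lambda>n. ereal (recovery_error \<gamma> A n))"
    by (intro Limsup_bounded[THEN order_trans, OF _ order.refl] le_Limsup) auto
  with \<delta> have "ereal (1 / 2 - \<delta> / 2) \<le> ereal (1 / 2 - \<delta>)" using order_trans by blast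
  with \<delta>(1) show False by simp
qed

section \<open>Ranking by score on the random access machine\<close>

text \<open>Wins minus losses, which orders the players of a tournament in the same way as the
  number of wins.\<close>

definition score :: "nat \<Rightarrow> matrix \<Rightarrow> nat \<Rightarrow> int" where
  "score n T i = (\<Sum>j<n. T i j)"

text \<open>Breaking ties by the index makes this a strict total order, so that the ranks form a
  permutation.\<close>

definition outranks :: "nat \<Rightarrow> matrix \<Rightarrow> nat \<Rightarrow> nat \<Rightarrow> bool" where
  "outranks n T i j \<longleftrightarrow> score n T j < score n T i \<or> score n T j = score n T i \<and> i < j"

text \<open>A high score gives a low rank, as the planted order puts the stronger players first. The
  value outside the index range is what \<open>permutes\<close> demands.\<close>

definition rank_by_score :: estimator where
  "rank_by_score n T i = (if i < n then card {j. j < n \<and> outranks n T j i} else i)"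

lemma rank_by_score_less_iff:
  assumes "i < n" "j < n"
  shows "rank_by_score n T i < rank_by_score n T j \<longleftrightarrow> outranks n T i j"
proof -
  have mono: "card {k. k < n \<and> outranks n T k i} < card {k. k < n \<and> outranks n T k j}"
    if "outranks n T i j" "i < n" for i j
  proof (rule psubset_card_mono)
    show "{k. k < n \<and> outranks n T k i} \<subset> {k. k < n \<and> outranks n T k j}"
      using that by (auto simp: outranks_def)
  qed auto
  have "outranks n T i j \<or> outranks n T j i \<or> i = j"
    by (auto simp: outranks_def)
  with mono[of i j] mono[of j i] assms show ?thesis
    by (auto simp: rank_by_score_def outranks_def)
qed

lemma algorithm_rank_by_score: "algorithm rank_by_score"
  unfolding algorithm_def
proof (intro allI impI)
  fix n T
  have inj: "inj_on (rank_by_score n T) {..<n}"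
  proof (rule inj_onI)
    fix i j assume "i \<in> {..<n}" "j \<in> {..<n}" "rank_by_score n T i = rank_by_score n T j"
    then show "i = j"
      using rank_by_score_less_iff[of i n j T] rank_by_score_less_iff[of j n i T]
      by (auto simp: outranks_def)
  qed
  have "rank_by_score n T i < n" if "i < n" for i
  proof -
    have "card {j. j < n \<and> outranks n T j i} < card {..<n}"
      using that by (intro psubset_card_mono) (auto simp: outranks_def)
    then show ?thesis using that by (simp add: rank_by_score_def)
  qed
  then have "rank_by_score n T ` {..<n} \<subseteq> {..<n}" by auto
  with inj have "bij_betw (rank_by_score n T) {..<n} {..<n}"
    unfolding bij_betw_def using endo_inj_surj by blast
  then show "rank_by_score n T permutes {..<n}"
    by (rule bij_imp_permutes) (simp add: rank_by_score_def)
qed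

section \<open>A program logic for total correctness with time budgets\<close>

definition runs :: "com \<Rightarrow> nat \<Rightarrow> state \<Rightarrow> (state \<Rightarrow> bool) \<Rightarrow> bool" where
  "runs c b s Q \<longleftrightarrow> (\<exists>k s'. k \<le> b \<and> exec c s k s' \<and> Q s')"

lemma runs_Skip: "Q s \<Longrightarrow> runs Skip 1 s Q"
  unfolding runs_def using exec.Skip by blast

lemma runs_Const: "Q (r(x := c), m) \<Longrightarrow> runs (Const x c) 1 (r, m) Q"
  unfolding runs_def using exec.Const by blast

lemma runs_Add: "Q (r(x := r y + r z), m) \<Longrightarrow> runs (Add x y z) 1 (r, m) Q"
  unfolding runs_def using exec.Add by blast

lemma runs_Sub: "Q (r(x := r y - r z), m) \<Longrightarrow> runs (Sub x y z) 1 (r, m) Q"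
  unfolding runs_def using exec.Sub by blast

lemma runs_Load: "Q (r(x := m (r a)), m) \<Longrightarrow> runs (Load x a) 1 (r, m) Q"
  unfolding runs_def using exec.Load by blast

lemma runs_Store: "Q (r, m(r a := r x)) \<Longrightarrow> runs (Store a x) 1 (r, m) Q"
  unfolding runs_def using exec.Store by blast

text \<open>The intermediate assertion is the goal for the second program. Applying the rules along
  a block thus computes the final state and adds up the budget without assertions between
  instructions.\<close>

lemma runs_Seq: "runs c1 b1 s (\<lambda>s'. runs c2 b2 s' Q) \<Longrightarrow> runs (Seq c1 c2) (b1 + b2) s Q"
  unfolding runs_def by (blast intro: exec.Seq add_mono)

text \<open>Both branches cost the same and the conditional is kept inside the state, so that the
  verification of a block does not split.\<close>

lemma runs_Add_if:
  assumes "Q (if r x \<noteq> 0 then r(y := r y + r z) else r, m)"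
  shows "runs (If x (Add y y z) Skip) 2 (r, m) Q"
proof (cases "r x = 0")
  case True
  with assms exec.If_False[OF True exec.Skip[of "(r, m)"], of "Add y y z"] show ?thesis
    unfolding runs_def by (intro exI[of _ 2]) (auto simp: numeral_2_eq_2)
next
  case False
  with assms exec.If_True[OF False exec.Add[of y y z r m], of Skip] show ?thesis
    unfolding runs_def by (intro exI[of _ 2]) (auto simp: numeral_2_eq_2)
qed

lemma runs_mono: "runs c b s Q \<Longrightarrow> b \<le> b' \<Longrightarrow> runs c b' s Q"
  unfolding runs_def by (meson order_trans)

text \<open>The counter register \<open>x\<close> runs down from \<open>N\<close> to
  \<open>0\<close>. A round costs \<open>b\<close> plus one for its test, and the failing test is
  the last unit. The induction is on the number of remaining rounds.\<close>

lemma runs_While: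
  assumes step: "\<And>k r m. k < N \<Longrightarrow> Inv k r m \<Longrightarrow> runs c b (r, m) (\<lambda>(r', m'). Inv (Suc k) r' m')"
    and counter: "\<And>k r m. k \<le> N \<Longrightarrow> Inv k r m \<Longrightarrow> r x = N - k"
    and init: "Inv 0 r m"
    and final: "\<And>r m. Inv N r m \<Longrightarrow> Q (r, m)"
  shows "runs (While x c) (N * (b + 1) + 1) (r, m) Q"
proof -
  have "runs (While x c) (j * (b + 1) + 1) (r, m) Q" if "j \<le> N" "Inv (N - j) r m" for j r m
    using that
  proof (induction j arbitrary: r m)
    case 0
    then have "Inv N r m" by simp
    with counter[of N r m] have "r x = 0" by simp
    from exec.While_False[of r x, OF this] final[OF \<open>Inv N r m\<close>] show ?case
      unfolding runs_def by (intro exI[of _ 1]) auto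
  next
    case (Suc j)
    with counter[of "N - Suc j" r m] have x: "r x \<noteq> 0" by simp
    from step[OF _ Suc.prems(2)] Suc.prems(1) obtain k1 r' m'
      where 1: "k1 \<le> b" "exec c (r, m) k1 (r', m')" "Inv (Suc (N - Suc j)) r' m'"
      by (auto simp: runs_def)
    have "Suc (N - Suc j) = N - j" using Suc.prems(1) by simp
    with Suc.IH[of r' m'] 1(3) Suc.prems(1) obtain k2 s'
      where 2: "k2 \<le> j * (b + 1) + 1" "exec (While x c) (r', m') k2 s'" "Q s'"
      by (auto simp: runs_def)
    have "1 + k1 + k2 \<le> Suc j * (b + 1) + 1" using 1(1) 2(1) by simp
    with exec.While_True[of r x, OF x 1(2) 2(2)] 2(3) show ?case
      unfolding runs_def by blast
  qed
  from this[of N] init show ?thesis by simp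
qed

lemmas runs_basic =
  runs_Seq runs_Skip runs_Const runs_Add runs_Sub runs_Load runs_Store runs_Add_if

text \<open>The closing \<open>Skip\<close> costs one unit, which the budgets below include.\<close>

definition block :: "com list \<Rightarrow> com" where
  "block cs = foldr Seq cs Skip"

lemma block_simps [simp]: "block [] = Skip" "block (c # cs) = Seq c (block cs)"
  by (simp_all add: block_def)

text \<open>
  Register \<open>0\<close> holds \<open>n\<close>, register \<open>1\<close> the constant \<open>1\<close>, and register \<open>9\<close> stays \<open>0\<close>, so that
  \<open>Add x y 9\<close> copies; \<open>2\<close> and \<open>3\<close> are the counters of the outer and inner loop, \<open>4\<close> and \<open>5\<close> the
  corresponding indices or addresses.
  The row sum of row \<open>i\<close> overwrites cell \<open>i\<close>; this cell belongs to row \<open>0\<close>, which has been read by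
  then. The ranks are first collected in the cells \<open>n, \<dots>, 2 n - 1\<close> because all row sums are
  needed until the last comparison.
\<close>

definition row_sum_body :: com where
  "row_sum_body = block [Load 7 5, Add 6 6 7, Add 5 5 1, Sub 3 3 1]"

definition score_body :: com where
  "score_body = block [Const 6 0, Add 3 0 9, While 3 row_sum_body, Store 4 6, Add 4 4 1, Sub 2 2 1]"

definition count_body :: com where
  "count_body = block [Load 7 5, Sub 10 4 5, If 10 (Add 7 7 1) Skip,
     Sub 10 7 6, If 10 (Add 8 8 1) Skip, Add 5 5 1, Sub 3 3 1]"

definition rank_body :: com where
  "rank_body = block [Load 6 4, Const 8 0, Const 5 0, Add 3 0 9, While 3 count_body,
     Add 10 4 0, Store 10 8, Add 4 4 1, Sub 2 2 1]"

definition copy_body :: com where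
  "copy_body = block [Load 7 5, Store 4 7, Add 4 4 1, Add 5 5 1, Sub 2 2 1]"

definition rank_program :: com where
  "rank_program = block [Const 1 1,
     Add 2 0 9, While 2 score_body,
     Const 4 0, Add 2 0 9, While 2 rank_body,
     Const 4 0, Add 2 0 9, Add 5 0 9, While 2 copy_body]"

text \<open>An arbitrary \<open>Q\<close> with the facts on the final registers as a premise lets
  the inner loop be used like a rule for a single instruction.\<close>

lemma runs_row_sum:
  assumes post: "\<And>r'. r' 0 = r 0 \<Longrightarrow> r' 1 = 1 \<Longrightarrow> r' 2 = r 2 \<Longrightarrow> r' 4 = r 4 \<Longrightarrow> r' 9 = r 9 \<Longrightarrow>
      r' 5 = r 5 + n \<Longrightarrow> r' 6 = (\<Sum>j<n. m (r 5 + j)) \<Longrightarrow> Q (r', m)"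
    and "r 1 = 1" "r 3 = n" "r 6 = 0"
  shows "runs (While 3 row_sum_body) (n * (5 + 1) + 1) (r, m) Q"
proof -
  define Inv :: "nat \<Rightarrow> (nat \<Rightarrow> nat) \<Rightarrow> (nat \<Rightarrow> nat) \<Rightarrow> bool" where
    "Inv l r' m' \<longleftrightarrow> m' = m \<and> r' 0 = r 0 \<and> r' 1 = 1 \<and> r' 2 = r 2 \<and> r' 4 = r 4 \<and> r' 9 = r 9 \<and>
      r' 3 = n - l \<and> r' 5 = r 5 + l \<and> r' 6 = (\<Sum>j<l. m (r 5 + j))" for l r' m'
  show ?thesis
  proof (rule runs_While[where Inv = Inv])
    fix k r' m' assume "k < n" "Inv k r' m'"
    then show "runs row_sum_body 5 (r', m') (\<lambda>(r', m'). Inv (Suc k) r' m')"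
      unfolding row_sum_body_def block_simps
      by - (rule runs_mono, (rule runs_basic)+, auto simp: Inv_def)
  next
    fix r' m' assume "Inv n r' m'"
    then show "Q (r', m')" using post[of r'] by (auto simp: Inv_def)
  qed (use assms(2-4) in \<open>auto simp: Inv_def\<close>)
qed

lemma runs_scores:
  assumes post: "\<And>r' m'. r' 0 = n \<Longrightarrow> r' 1 = 1 \<Longrightarrow> r' 9 = 0 \<Longrightarrow>
      (\<And>i. i < n \<Longrightarrow> m' i = (\<Sum>j<n. m (i * n + j))) \<Longrightarrow> Q (r', m')"
    and "r 0 = n" "r 1 = 1" "r 2 = n" "r 4 = 0" "r 5 = 0" "r 9 = 0"
  shows "runs (While 2 score_body) (n * (6 * n + 7 + 1) + 1) (r, m) Q"
proof -
  define Inv :: "nat \<Rightarrow> (nat \<Rightarrow> nat) \<Rightarrow> (nat \<Rightarrow> nat) \<Rightarrow> bool" where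
    "Inv k r' m' \<longleftrightarrow> m' = (\<lambda>a. if a < k then \<Sum>j<n. m (a * n + j) else m a) \<and>
      r' 0 = n \<and> r' 1 = 1 \<and> r' 9 = 0 \<and> r' 2 = n - k \<and> r' 4 = k \<and> r' 5 = k * n" for k r' m'
  show ?thesis
  proof (rule runs_While[where Inv = Inv])
    fix k r' m' assume k: "k < n" and inv: "Inv k r' m'"
    \<comment> \<open>The first \<open>k\<close> cells already hold row sums; row \<open>k\<close>
      starts at cell \<open>k * n\<close> and so avoids them.\<close>
    have "k \<le> k * n" using k by (cases n) auto
    then have "\<not> k * n + j < k" for j by linarith
    with inv have row: "(\<Sum>j<n. m' (k * n + j)) = (\<Sum>j<n. m (k * n + j))"
      by (simp add: Inv_def)
    from k inv show "runs score_body (6 * n + 7) (r', m') (\<lambda>(r', m'). Inv (Suc k) r' m')"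
      unfolding score_body_def block_simps
      by - (rule runs_mono, (rule runs_row_sum[where n = n] runs_basic)+,
          use row in \<open>auto simp: Inv_def less_Suc_eq\<close>)
  next
    fix r' m' assume "Inv n r' m'"
    then show "Q (r', m')" by (intro post) (auto simp: Inv_def)
  qed (use assms in \<open>auto simp: Inv_def\<close>)
qed

lemma card_less_Suc_filter:
  "card {j. j < Suc l \<and> P j} = card {j. j < l \<and> P j} + of_bool (P l)"
proof -
  have "{j. j < Suc l \<and> P j} = {j. j < l \<and> P j} \<union> (if P l then {l} else {})"
    by (auto simp: less_Suc_eq)
  then show ?thesis by simp
qed

text \<open>The test expresses \<open>outranks\<close> on natural numbers: adding \<open>1\<close>
  to the row sum of an earlier player turns the strict comparison into a weak one, and truncated
  subtraction is nonzero exactly if the comparison is strict.\<close>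

lemma runs_count:
  assumes post: "\<And>r'. r' 0 = r 0 \<Longrightarrow> r' 1 = 1 \<Longrightarrow> r' 2 = r 2 \<Longrightarrow> r' 4 = r 4 \<Longrightarrow> r' 9 = r 9 \<Longrightarrow>
      r' 8 = card {j. j < n \<and> r 6 < m j + of_bool (j < r 4)} \<Longrightarrow> Q (r', m)"
    and "r 1 = 1" "r 3 = n" "r 5 = 0" "r 8 = 0"
  shows "runs (While 3 count_body) (n * (10 + 1) + 1) (r, m) Q"
proof -
  define Inv :: "nat \<Rightarrow> (nat \<Rightarrow> nat) \<Rightarrow> (nat \<Rightarrow> nat) \<Rightarrow> bool" where
    "Inv l r' m' \<longleftrightarrow> m' = m \<and> r' 0 = r 0 \<and> r' 1 = 1 \<and> r' 2 = r 2 \<and> r' 4 = r 4 \<and> r' 9 = r 9 \<and>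
      r' 6 = r 6 \<and> r' 3 = n - l \<and> r' 5 = l \<and>
      r' 8 = card {j. j < l \<and> r 6 < m j + of_bool (j < r 4)}" for l r' m'
  show ?thesis
  proof (rule runs_While[where Inv = Inv])
    fix k r' m' assume "k < n" "Inv k r' m'"
    then show "runs count_body 10 (r', m') (\<lambda>(r', m'). Inv (Suc k) r' m')"
      unfolding count_body_def block_simps
      by - (rule runs_mono, (rule runs_basic)+, auto simp: Inv_def card_less_Suc_filter)
  next
    fix r' m' assume "Inv n r' m'"
    then show "Q (r', m')" using post[of r'] by (auto simp: Inv_def)
  qed (use assms(2-5) in \<open>auto simp: Inv_def\<close>)
qed

lemma runs_ranks:
  assumes post: "\<And>r' m'. r' 0 = n \<Longrightarrow> r' 1 = 1 \<Longrightarrow> r' 9 = 0 \<Longrightarrow>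
      (\<And>i. i < n \<Longrightarrow> m' (n + i) = card {j. j < n \<and> m i < m j + of_bool (j < i)}) \<Longrightarrow> Q (r', m')"
    and "r 0 = n" "r 1 = 1" "r 2 = n" "r 4 = 0" "r 9 = 0"
  shows "runs (While 2 rank_body) (n * (11 * n + 10 + 1) + 1) (r, m) Q"
proof -
  define Inv :: "nat \<Rightarrow> (nat \<Rightarrow> nat) \<Rightarrow> (nat \<Rightarrow> nat) \<Rightarrow> bool" where
    "Inv k r' m' \<longleftrightarrow> (\<forall>a<n. m' a = m a) \<and>
      (\<forall>i<k. m' (n + i) = card {j. j < n \<and> m i < m j + of_bool (j < i)}) \<and>
      r' 0 = n \<and> r' 1 = 1 \<and> r' 9 = 0 \<and> r' 2 = n - k \<and> r' 4 = k" for k r' m'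
  show ?thesis
  proof (rule runs_While[where Inv = Inv])
    fix k r' m' assume k: "k < n" and inv: "Inv k r' m'"
    have count: "{j. j < n \<and> m' k < m' j + of_bool (j < k)} = {j. j < n \<and> m k < m j + of_bool (j < k)}"
      using inv k by (auto simp: Inv_def)
    from k inv show "runs rank_body (11 * n + 10) (r', m') (\<lambda>(r', m'). Inv (Suc k) r' m')"
      unfolding rank_body_def block_simps
      by - (rule runs_mono, (rule runs_count[where n = n] runs_basic)+,
          use count in \<open>auto simp: Inv_def less_Suc_eq\<close>)
  next
    fix r' m' assume "Inv n r' m'"
    then show "Q (r', m')" by (intro post) (auto simp: Inv_def)
  qed (use assms in \<open>auto simp: Inv_def\<close>)
qed

lemma runs_copy:
  assumes post: "\<And>r' m'. (\<And>i. i < n \<Longrightarrow> m' i = m (n + i)) \<Longrightarrow> Q (r', m')"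
    and "r 1 = 1" "r 2 = n" "r 4 = 0" "r 5 = n"
  shows "runs (While 2 copy_body) (n * (6 + 1) + 1) (r, m) Q"
proof -
  define Inv :: "nat \<Rightarrow> (nat \<Rightarrow> nat) \<Rightarrow> (nat \<Rightarrow> nat) \<Rightarrow> bool" where
    "Inv k r' m' \<longleftrightarrow> (\<forall>i<k. m' i = m (n + i)) \<and> (\<forall>i<n. m' (n + i) = m (n + i)) \<and>
      r' 1 = 1 \<and> r' 2 = n - k \<and> r' 4 = k \<and> r' 5 = n + k" for k r' m'
  show ?thesis
  proof (rule runs_While[where Inv = Inv])
    fix k r' m' assume "k < n" "Inv k r' m'"
    then show "runs copy_body 6 (r', m') (\<lambda>(r', m'). Inv (Suc k) r' m')"
      unfolding copy_body_def block_simps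
      by - (rule runs_mono, (rule runs_basic)+, auto simp: Inv_def less_Suc_eq)
  next
    fix r' m' assume "Inv n r' m'"
    then show "Q (r', m')" by (intro post) (auto simp: Inv_def)
  qed (use assms in \<open>auto simp: Inv_def\<close>)
qed

text \<open>The budget consists of the three loops, \<open>n * (6 * n + 8) + 1\<close>,
  \<open>n * (11 * n + 11) + 1\<close> and \<open>7 * n + 1\<close>, and of eight single
  steps.\<close>

lemma runs_rank_program:
  assumes "r 0 = n" "\<And>x. x \<noteq> 0 \<Longrightarrow> r x = 0"
    and post: "\<And>r' m'. (\<And>i. i < n \<Longrightarrow> m' i = card {j. j < n \<and>
      (\<Sum>l<n. m (i * n + l)) < (\<Sum>l<n. m (j * n + l)) + of_bool (j < i)}) \<Longrightarrow> Q (r', m')"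
  shows "runs rank_program (17 * n * n + 26 * n + 11) (r, m) Q"
  unfolding rank_program_def block_simps
  apply (rule runs_mono)
   apply ((rule runs_scores[where n = n] runs_ranks[where n = n] runs_copy[where n = n] runs_basic)+)
   apply (rule post)
  using assms(1,2) apply (auto simp: algebra_simps cong: conj_cong)
  done

lemma polynomial_time_rank_by_score: "polynomial_time rank_by_score"
  unfolding polynomial_time_def
proof (intro exI[of _ rank_program] exI[of _ "[:11, 26, 17:]"] allI impI)
  fix n T assume T: "tournament n T"
  obtain r m where rm: "input_state n T = (r, m)" by (cases "input_state n T")
  define w where "w i = (\<Sum>l<n. m (i * n + l))" for i
  \<comment> \<open>The encoding adds \<open>1\<close> to each entry, also to the zero on the
    diagonal, so every row sum exceeds the score by the same amount and comparisons are
    unaffected.\<close>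
  have row: "int (w i) = score n T i + int n" if "i < n" for i
  proof -
    have "int (m (i * n + l)) = T i l + 1" if "l < n" for l
    proof -
      have "i * n + l < Suc i * n" using that by simp
      also have "\<dots> \<le> n * n" using \<open>i < n\<close> by (intro mult_right_mono) auto
      finally have "i * n + l < n * n" .
      moreover have "T i l \<in> {-1, 0, 1}"
      proof (cases "i = l")
        case True
        have "T i i = - T i i" using T unfolding tournament_def by blast
        with True show ?thesis by simp
      next
        case False
        then show ?thesis using T that \<open>i < n\<close> unfolding tournament_def by blast
      qed
      ultimately show ?thesis using rm that by (auto simp: input_state_def)
    qed
    then show ?thesis by (simp add: w_def score_def sum.distrib)
  qed
  have rank: "card {j. j < n \<and> w i < w j + of_bool (j < i)} = rank_by_score n T i"
    if "i < n" for i
  proof -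
    have "w i < w j + of_bool (j < i) \<longleftrightarrow> outranks n T j i"
      if "j < n" for j
      using row[OF \<open>i < n\<close>] row[OF that] by (auto simp: outranks_def)
    then have "{j. j < n \<and> w i < w j + of_bool (j < i)} = {j. j < n \<and> outranks n T j i}"
      by blast
    with \<open>i < n\<close> show ?thesis by (simp add: rank_by_score_def)
  qed
  have "runs rank_program (17 * n * n + 26 * n + 11) (r, m)
      (\<lambda>(r', m'). \<forall>i<n. m' i = rank_by_score n T i)"
    by (rule runs_rank_program) (use rm rank in \<open>auto simp: input_state_def w_def\<close>)
  then obtain k r' m' where "k \<le> 17 * n * n + 26 * n + 11"
      "exec rank_program (input_state n T) k (r', m')" "\<forall>i<n. m' i = rank_by_score n T i"
    unfolding rm by (auto simp: runs_def)
  then show "\<exists>k r m. k \<le> poly [:11, 26, 17:] n \<and> exec rank_program (input_state n T) k (r, m) \<and>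
      (\<forall>i<n. m i = rank_by_score n T i)"
    by (intro exI conjI) (auto simp: algebra_simps)
qed

section \<open>Strong recovery\<close>

lemma score_relabel:
  assumes "\<tau> permutes {..<n}"
  shows "score n (relabel \<tau> T) a = score n T (\<tau> a)"
  unfolding score_def relabel_def using sum.permute[OF assms, of "T (\<tau> a)"] by (simp add: o_def)

text \<open>Relabelling turns the error under the exchanged permutation into an event under
  \<open>\<pi>\<close> with the scores of \<open>i\<close> and \<open>j\<close> exchanged. At equal
  scores exactly one of the two tie-breaks is an error, so the indicators add up to
  \<open>1 - sgn D\<close> for the score difference \<open>D\<close> also when
  \<open>D = 0\<close>.\<close>

lemma rank_by_score_error:
  assumes "0 \<le> \<gamma> n" "\<gamma> n \<le> 1 / 2" "2 \<le> n"
  shows "2 * fact n * real (n choose 2) * recovery_error \<gamma> rank_by_score n =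
    (\<Sum>\<pi>\<in>perms n. \<Sum>(i, j)\<in>ordered_pairs n \<pi>.
       1 - mean n (\<gamma> n) \<pi> (\<lambda>T. sgn (real_of_int (score n T i - score n T j))))"
  unfolding kendall_error[of \<gamma>, OF assms]
proof (intro sum.cong refl, clarify)
  fix \<pi> i j assume \<pi>: "\<pi> permutes {..<n}" and ij: "(i, j) \<in> ordered_pairs n \<pi>"
  have lt: "i < n" "j < n" "i \<noteq> j" using ij by (auto simp: ordered_pairs_def)
  have \<tau>: "swap i j permutes {..<n}" using lt by (intro permutes_swap_id) auto
  have "mean n (\<gamma> n) \<pi> (\<lambda>T. of_bool (rank_by_score n T j < rank_by_score n T i)) +
      mean n (\<gamma> n) (\<pi> \<circ> swap i j) (\<lambda>T. of_bool (rank_by_score n T i < rank_by_score n T j)) =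
      mean n (\<gamma> n) \<pi> (\<lambda>T. of_bool (outranks n T j i) + of_bool (outranks n (relabel (swap i j) T) i j))"
    unfolding mean_relabel[OF \<tau>] mean_add using lt by (simp add: rank_by_score_less_iff)
  also have "\<dots> = mean n (\<gamma> n) \<pi> (\<lambda>T. 1 - sgn (real_of_int (score n T i - score n T j)))"
    using lt by (intro arg_cong[of _ _ "mean n (\<gamma> n) \<pi>"] ext)
      (auto simp: outranks_def score_relabel[OF \<tau>] sgn_if)
  finally show "mean n (\<gamma> n) \<pi> (\<lambda>T. of_bool (rank_by_score n T j < rank_by_score n T i)) +
      mean n (\<gamma> n) (\<pi> \<circ> swap i j) (\<lambda>T. of_bool (rank_by_score n T i < rank_by_score n T j)) =
      1 - mean n (\<gamma> n) \<pi> (\<lambda>T. sgn (real_of_int (score n T i - score n T j)))"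
    by (simp add: mean_diff mean_const[OF \<pi>])
qed

section \<open>Moments of linear forms in the entries and of score differences\<close>

lemma sum_square_ordered_pairs:
  fixes f :: "nat \<Rightarrow> nat \<Rightarrow> 'a::comm_monoid_add"
  assumes \<pi>: "\<pi> permutes {..<n}" and diag: "\<And>a. f a a = 0"
  shows "(\<Sum>a<n. \<Sum>b<n. f a b) = (\<Sum>(a, b)\<in>ordered_pairs n \<pi>. f a b + f b a)"
proof -
  let ?P = "ordered_pairs n \<pi>"
  let ?P' = "(\<lambda>(a, b). (b, a)) ` ?P" and ?D = "(\<lambda>a. (a, a)) ` {..<n}"
  have "{..<n} \<times> {..<n} = ?P \<union> ?P' \<union> ?D"
    using ordered_pairs_total[OF \<pi>] by (force simp: ordered_pairs_def)
  moreover have "(\<Sum>(a, b)\<in>?P \<union> ?P' \<union> ?D. f a b) =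
      (\<Sum>(a, b)\<in>?P. f a b) + (\<Sum>(a, b)\<in>?P'. f a b) + (\<Sum>(a, b)\<in>?D. f a b)"
    by (subst sum.union_disjoint; (subst sum.union_disjoint)?) (auto dest: ordered_pairs_asym)
  moreover have "(\<Sum>(a, b)\<in>?P'. f a b) = (\<Sum>(a, b)\<in>?P. f b a)"
    by (subst sum.reindex) (auto simp: inj_on_def case_prod_unfold)
  moreover have "(\<Sum>(a, b)\<in>?D. f a b) = 0"
    by (subst sum.reindex) (auto simp: inj_on_def diag)
  ultimately show ?thesis
    by (simp add: sum.cartesian_product sum.distrib case_prod_unfold)
qed

text \<open>The coefficients are indexed independently of \<open>\<pi>\<close>. On tournaments only
  \<open>e a b - e b a\<close> matters, and the moments below are expressed through it.\<close>

definition form :: "nat \<Rightarrow> (nat \<Rightarrow> nat \<Rightarrow> real) \<Rightarrow> matrix \<Rightarrow> real" where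
  "form n e T = (\<Sum>a<n. \<Sum>b<n. e a b * T a b)"

lemma form_ordered_pairs:
  assumes "\<pi> permutes {..<n}" "T \<in> tournaments n"
  shows "form n e T = (\<Sum>p\<in>ordered_pairs n \<pi>. (e (fst p) (snd p) - e (snd p) (fst p)) * T (fst p) (snd p))"
proof -
  have "T a a = 0" for a using tournament_antisym[OF assms(2), of a a] by simp
  then have "form n e T = (\<Sum>(a, b)\<in>ordered_pairs n \<pi>. e a b * T a b + e b a * T b a)"
    unfolding form_def by (intro sum_square_ordered_pairs[OF assms(1)]) simp
  also have "\<dots> = (\<Sum>(a, b)\<in>ordered_pairs n \<pi>. (e a b - e b a) * T a b)"
    by (intro sum.cong refl, clarify) (subst tournament_antisym[OF assms(2)], simp add: algebra_simps)
  finally show ?thesis by (simp add: case_prod_unfold)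
qed

lemma mean_cong:
  "(\<And>T. T \<in> tournaments n \<Longrightarrow> f T = g T) \<Longrightarrow> mean n \<gamma> \<pi> f = mean n \<gamma> \<pi> g"
  unfolding mean_def by (intro sum.cong) auto

lemma mean_form:
  assumes "\<pi> permutes {..<n}"
  shows "mean n \<gamma> \<pi> (form n e) = 2 * \<gamma> * (\<Sum>(a, b)\<in>ordered_pairs n \<pi>. e a b - e b a)"
proof -
  have "mean n \<gamma> \<pi> (form n e) = mean n \<gamma> \<pi> (\<lambda>T. \<Sum>p\<in>ordered_pairs n \<pi>.
      (e (fst p) (snd p) - e (snd p) (fst p)) * T (fst p) (snd p))"
    by (intro mean_cong form_ordered_pairs assms)
  also have "\<dots> = 2 * \<gamma> * (\<Sum>p\<in>ordered_pairs n \<pi>. e (fst p) (snd p) - e (snd p) (fst p))"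
    by (rule mean_linear[OF assms])
  finally show ?thesis by (simp add: case_prod_unfold)
qed

lemma variance_form_le:
  assumes "\<pi> permutes {..<n}"
  shows "mean n \<gamma> \<pi> (\<lambda>T. (form n e T - mean n \<gamma> \<pi> (form n e))\<^sup>2) \<le>
    (\<Sum>(a, b)\<in>ordered_pairs n \<pi>. (e a b - e b a)\<^sup>2)"
proof -
  let ?c = "\<lambda>p. e (fst p) (snd p) - e (snd p) (fst p)"
  have "mean n \<gamma> \<pi> (\<lambda>T. (form n e T - mean n \<gamma> \<pi> (form n e))\<^sup>2) =
      mean n \<gamma> \<pi> (\<lambda>T. (\<Sum>p\<in>ordered_pairs n \<pi>. ?c p * (T (fst p) (snd p) - 2 * \<gamma>))\<^sup>2)"
    by (intro mean_cong) (simp add: form_ordered_pairs[OF assms] mean_form[OF assms]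
        right_diff_distrib sum_subtractf case_prod_unfold sum_distrib_left mult_ac)
  also have "\<dots> = (1 - 4 * \<gamma>\<^sup>2) * (\<Sum>p\<in>ordered_pairs n \<pi>. (?c p)\<^sup>2)"
    by (rule mean_linear_centered_sq[OF assms])
  also have "\<dots> \<le> 1 * (\<Sum>p\<in>ordered_pairs n \<pi>. (?c p)\<^sup>2)"
    by (intro mult_right_mono sum_nonneg) auto
  finally show ?thesis by (simp add: case_prod_unfold)
qed

definition score_coeff :: "nat \<Rightarrow> nat \<Rightarrow> nat \<Rightarrow> real" where
  "score_coeff i j a = of_bool (a = i) - of_bool (a = j)"

lemma score_diff_form:
  assumes "i < n" "j < n"
  shows "real_of_int (score n T i - score n T j) = form n (\<lambda>a b. score_coeff i j a) T"
proof -
  have "form n (\<lambda>a b. score_coeff i j a) T =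
      (\<Sum>a<n. of_bool (a = i) * score n T a) - (\<Sum>a<n. of_bool (a = j) * score n T a)"
    by (simp add: form_def score_coeff_def score_def left_diff_distrib sum_subtractf sum_distrib_left)
  then show ?thesis using assms by simp
qed

lemma mean_score_diff:
  assumes \<pi>: "\<pi> permutes {..<n}" and "i < n" "j < n"
  shows "mean n \<gamma> \<pi> (\<lambda>T. score n T i - score n T j) = 4 * \<gamma> * (real (\<pi> j) - real (\<pi> i))"
proof -
  \<comment> \<open>Player \<open>k\<close> precedes \<open>n - 1 - \<pi> k\<close> players and
    follows \<open>\<pi> k\<close> of them.\<close>
  have key: "(\<Sum>(a, b)\<in>ordered_pairs n \<pi>. of_bool (a = k) - of_bool (b = k)) = real n - 1 - 2 * real (\<pi> k)"
    if "k < n" for k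
  proof -
    have inj: "\<pi> a = \<pi> k \<longleftrightarrow> a = k" for a
      using permutes_inj[OF \<pi>] by (auto simp: inj_def)
    have lt: "\<pi> k < n" using permutes_in_image[OF \<pi>] that by simp
    have "(\<Sum>(a, b)\<in>ordered_pairs n \<pi>. of_bool (a = k) - of_bool (b = k) :: real) =
        (\<Sum>b<n. \<Sum>a<b. of_bool (a = \<pi> k) - of_bool (b = \<pi> k))"
      using sum_ordered_pairs[OF \<pi>, of "\<lambda>a b. of_bool (a = \<pi> k) - of_bool (b = \<pi> k) :: real"]
      by (simp add: inj)
    also have "\<dots> = (\<Sum>b<n. of_bool (\<pi> k < b)) - (\<Sum>b<n. of_bool (b = \<pi> k) * real b)"
      unfolding sum_subtractf[symmetric]
      by (intro sum.cong refl) (simp add: sum_subtractf of_bool_def)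
    also have "(\<Sum>b<n. of_bool (l < b)) = real n - 1 - real l" if "l < n" for l
      using that by (induction n) (auto simp: less_Suc_eq not_less_iff_gr_or_eq)
    also have "(\<Sum>b<n. of_bool (b = \<pi> k) * real b) = real (\<pi> k)"
      using lt by simp
    finally show ?thesis using lt by simp
  qed
  have "mean n \<gamma> \<pi> (\<lambda>T. score n T i - score n T j) =
      2 * \<gamma> * (\<Sum>(a, b)\<in>ordered_pairs n \<pi>. score_coeff i j a - score_coeff i j b)"
    unfolding score_diff_form[OF assms(2,3)] by (rule mean_form[OF \<pi>])
  also have "(\<Sum>(a, b)\<in>ordered_pairs n \<pi>. score_coeff i j a - score_coeff i j b) =
      (\<Sum>(a, b)\<in>ordered_pairs n \<pi>. of_bool (a = i) - of_bool (b = i)) -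
      (\<Sum>(a, b)\<in>ordered_pairs n \<pi>. of_bool (a = j) - of_bool (b = j))"
    unfolding sum_subtractf[symmetric] by (intro sum.cong refl) (auto simp: score_coeff_def)
  finally show ?thesis using key assms(2,3) by simp
qed

lemma sum_of_bool_mem: "finite A \<Longrightarrow> (\<Sum>x\<in>A. of_bool (x \<in> S)) = real (card (A \<inter> S))"
  by simp

text \<open>The antisymmetrised coefficient vanishes unless the pair contains \<open>i\<close> or
  \<open>j\<close>, and is at most \<open>2\<close> in absolute value; at most \<open>4 * n\<close>
  pairs are affected.\<close>

lemma variance_score_diff_le:
  assumes \<pi>: "\<pi> permutes {..<n}" and "i < n" "j < n"
  shows "mean n \<gamma> \<pi> (\<lambda>T. (score n T i - score n T j - 4 * \<gamma> * (real (\<pi> j) - real (\<pi> i)))\<^sup>2) \<le> 16 * real n"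
proof -
  let ?S = "{i, j} \<times> {..<n} \<union> {..<n} \<times> {i, j}"
  have "mean n \<gamma> \<pi> (\<lambda>T. (score n T i - score n T j - 4 * \<gamma> * (real (\<pi> j) - real (\<pi> i)))\<^sup>2) \<le>
      (\<Sum>(a, b)\<in>ordered_pairs n \<pi>. (score_coeff i j a - score_coeff i j b)\<^sup>2)"
    using variance_form_le[OF \<pi>, of \<gamma> "\<lambda>a b. score_coeff i j a"]
    unfolding score_diff_form[OF assms(2,3), symmetric] mean_score_diff[OF assms] by simp
  also have "\<dots> \<le> (\<Sum>(a, b)\<in>ordered_pairs n \<pi>. 4 * of_bool ((a, b) \<in> ?S))"
    by (intro sum_mono) (auto simp: score_coeff_def ordered_pairs_def)
  also have "\<dots> = (\<Sum>p\<in>ordered_pairs n \<pi>. 4 * of_bool (p \<in> ?S))"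
    by (simp only: case_prod_unfold prod.collapse)
  also have "\<dots> \<le> (\<Sum>p\<in>{..<n} \<times> {..<n}. 4 * of_bool (p \<in> ?S))"
    by (intro sum_mono2) (auto simp: ordered_pairs_def)
  also have "\<dots> = 4 * real (card (({..<n} \<times> {..<n}) \<inter> ?S))"
    by (simp only: sum_distrib_left[symmetric] sum_of_bool_mem finite_cartesian_product finite_lessThan)
  also have "card (({..<n} \<times> {..<n}) \<inter> ?S) \<le> card ?S"
    by (rule card_mono) auto
  also have "card ?S \<le> card ({i, j} \<times> {..<n}) + card ({..<n} \<times> {i, j})"
    by (rule card_Un_le)
  also have "\<dots> \<le> 2 * n + n * 2"
    unfolding card_cartesian_product by (intro add_mono mult_mono) (auto simp: card_insert_if)
  finally show ?thesis by simp
qed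

text \<open>Chebyshev's inequality in pointwise form: \<open>sgn d\<close> differs from
  \<open>1\<close> only if \<open>d \<le> 0\<close>, and then
  \<open>(d - \<mu>)\<^sup>2 \<ge> \<mu>\<^sup>2\<close>. The \<open>16\<close> of the variance
  cancels against the square of \<open>4 * \<gamma>\<close>.\<close>

lemma mean_sgn_score_diff_ge:
  assumes \<pi>: "\<pi> permutes {..<n}" and \<gamma>: "0 < \<gamma>" "\<gamma> \<le> 1 / 2" and ij: "(i, j) \<in> ordered_pairs n \<pi>"
  shows "1 - mean n \<gamma> \<pi> (\<lambda>T. sgn (real_of_int (score n T i - score n T j))) \<le>
    2 * real n / (\<gamma>\<^sup>2 * (real (\<pi> j) - real (\<pi> i))\<^sup>2)"
proof -
  have lt: "i < n" "j < n" and less: "\<pi> i < \<pi> j" using ij by (auto simp: ordered_pairs_def)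
  define \<mu> where "\<mu> = 4 * \<gamma> * (real (\<pi> j) - real (\<pi> i))"
  have \<mu>: "\<mu> > 0" using \<gamma> less by (simp add: \<mu>_def)
  have "1 - sgn d \<le> 2 / \<mu>\<^sup>2 * (d - \<mu>)\<^sup>2" for d :: real
  proof (cases "d \<le> 0")
    case True
    then have "\<mu>\<^sup>2 \<le> (\<mu> - d)\<^sup>2" using \<mu> by (intro power_mono) auto
    then have "1 \<le> (d - \<mu>)\<^sup>2 / \<mu>\<^sup>2" using \<mu> by (simp add: power2_commute)
    moreover have "1 - sgn d \<le> 2" by (auto simp: sgn_if)
    ultimately show ?thesis by simp
  qed simp
  then have "mean n \<gamma> \<pi> (\<lambda>T. 1 - sgn (real_of_int (score n T i - score n T j))) \<le>
      mean n \<gamma> \<pi> (\<lambda>T. 2 / \<mu>\<^sup>2 * (real_of_int (score n T i - score n T j) - \<mu>)\<^sup>2)"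
    using \<gamma> by (intro mean_mono) auto
  also have "\<dots> \<le> 2 / \<mu>\<^sup>2 * (16 * real n)"
    unfolding mean_cmult using variance_score_diff_le[OF \<pi> lt, of \<gamma>]
    by (intro mult_left_mono) (auto simp: \<mu>_def)
  also have "\<dots> = 2 * real n / (\<gamma>\<^sup>2 * (real (\<pi> j) - real (\<pi> i))\<^sup>2)"
    by (simp add: \<mu>_def power_mult_distrib)
  finally show ?thesis by (simp add: mean_diff mean_const[OF \<pi>])
qed

lemma two_choose_two: "2 * real (n choose 2) = real n * (real n - 1)"
  by (induction n) (auto simp: numeral_2_eq_2 algebra_simps)

lemma card_short_gaps:
  assumes "0 \<le> x"
  shows "real (card {a. a < b \<and> real b - real a < x}) \<le> x"
proof -
  have "{a. a < b \<and> real b - real a < x} \<subseteq> (\<lambda>k. b - k) ` {1..nat \<lfloor>x\<rfloor>}"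
  proof
    fix a assume "a \<in> {a. a < b \<and> real b - real a < x}"
    then have "a = b - (b - a)" "b - a \<in> {1..nat \<lfloor>x\<rfloor>}" by (auto simp: le_nat_floor)
    then show "a \<in> (\<lambda>k. b - k) ` {1..nat \<lfloor>x\<rfloor>}" by (rule image_eqI)
  qed
  then have "card {a. a < b \<and> real b - real a < x} \<le> card ((\<lambda>k. b - k) ` {1..nat \<lfloor>x\<rfloor>})"
    by (rule card_mono[rotated]) auto
  also have "\<dots> \<le> nat \<lfloor>x\<rfloor>" using card_image_le[of "{1..nat \<lfloor>x\<rfloor>}"] by simp
  finally have "real (card {a. a < b \<and> real b - real a < x}) \<le> real (nat \<lfloor>x\<rfloor>)" by simp
  also have "\<dots> \<le> x" using assms by simp
  finally show ?thesis .
qed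

lemma recovery_error_nonneg: "0 \<le> recovery_error \<gamma> A n"
  unfolding recovery_error_def by (intro divide_nonneg_nonneg Bochner_Integration.integral_nonneg) auto

text \<open>Positions closer than \<open>\<epsilon> * n\<close> are bounded trivially by
  \<open>2\<close>, all others by Chebyshev. Each position has at most \<open>\<epsilon> * n\<close>
  close ones below it, and \<open>n - 1 \<ge> n / 2\<close> yields the factor
  \<open>4\<close>.\<close>

lemma recovery_error_rank_by_score_le:
  assumes \<gamma>: "0 < \<gamma> n" "\<gamma> n \<le> 1 / 2" and n: "2 \<le> n" and \<epsilon>: "0 < \<epsilon>"
  shows "recovery_error \<gamma> rank_by_score n \<le> 4 * (\<epsilon> + 1 / ((\<gamma> n)\<^sup>2 * n * \<epsilon>\<^sup>2))"
proof -
  define X where "X = 1 / ((\<gamma> n)\<^sup>2 * n * \<epsilon>\<^sup>2)"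
  define \<phi> where "\<phi> a b = 2 * of_bool (real b - real a < \<epsilon> * n) + 2 * X" for a b :: nat
  have X: "0 \<le> X" by (simp add: X_def)
  have pair: "1 - mean n (\<gamma> n) \<pi> (\<lambda>T. sgn (real_of_int (score n T i - score n T j))) \<le> \<phi> (\<pi> i) (\<pi> j)"
    if \<pi>: "\<pi> permutes {..<n}" and ij: "(i, j) \<in> ordered_pairs n \<pi>" for \<pi> i j
  proof (cases "real (\<pi> j) - real (\<pi> i) < \<epsilon> * n")
    case True
    have "mean n (\<gamma> n) \<pi> (\<lambda>_. -1) \<le> mean n (\<gamma> n) \<pi> (\<lambda>T. sgn (real_of_int (score n T i - score n T j)))"
      using \<gamma> by (intro mean_mono) (auto simp: sgn_if)
    with True X show ?thesis by (simp add: \<phi>_def mean_const[OF \<pi>])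
  next
    case False
    moreover have "0 < \<epsilon> * n" using \<epsilon> n by simp
    ultimately have "0 < real (\<pi> j) - real (\<pi> i)" by linarith
    then have "2 * real n / ((\<gamma> n)\<^sup>2 * (real (\<pi> j) - real (\<pi> i))\<^sup>2) \<le> 2 * real n / ((\<gamma> n)\<^sup>2 * (\<epsilon> * n)\<^sup>2)"
      using False \<gamma> \<epsilon> n by (intro divide_left_mono mult_left_mono power_mono) auto
    also have "\<dots> = 2 * X" using n by (simp add: X_def power2_eq_square field_simps)
    finally show ?thesis
      using mean_sgn_score_diff_ge[OF \<pi> \<gamma> ij] False by (simp add: \<phi>_def)
  qed
  have "2 * fact n * real (n choose 2) * recovery_error \<gamma> rank_by_score n \<le>
      (\<Sum>\<pi>\<in>perms n. \<Sum>(i, j)\<in>ordered_pairs n \<pi>. \<phi> (\<pi> i) (\<pi> j))"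
    unfolding rank_by_score_error[of \<gamma>, OF less_imp_le[OF \<gamma>(1)] \<gamma>(2) n]
    using pair by (intro sum_mono) auto
  also have "\<dots> = fact n * (\<Sum>b<n. \<Sum>a<b. \<phi> a b)"
    by (simp add: sum_ordered_pairs card_perms)
  also have "(\<Sum>b<n. \<Sum>a<b. \<phi> a b) \<le> (\<Sum>b<n. 2 * (\<epsilon> * n) + n * (2 * X))"
  proof (rule sum_mono)
    fix b assume "b \<in> {..<n}"
    have "(\<Sum>a<b. \<phi> a b) = 2 * (\<Sum>a<b. of_bool (real b - real a < \<epsilon> * n)) + b * (2 * X)"
      by (simp add: \<phi>_def sum.distrib sum_distrib_left)
    also have "(\<Sum>a<b. of_bool (real b - real a < \<epsilon> * n)) = real (card {a. a < b \<and> real b - real a < \<epsilon> * n})"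
      by (simp add: Int_def lessThan_def)
    also have "\<dots> \<le> \<epsilon> * n"
      using \<epsilon> by (intro card_short_gaps) auto
    also have "b * (2 * X) \<le> n * (2 * X)"
      using \<open>b \<in> {..<n}\<close> X by (intro mult_right_mono) auto
    finally show "(\<Sum>a<b. \<phi> a b) \<le> 2 * (\<epsilon> * n) + n * (2 * X)" by simp
  qed
  finally have "fact n * (2 * real (n choose 2) * recovery_error \<gamma> rank_by_score n) \<le>
      fact n * (2 * (real n * real n) * (\<epsilon> + X))"
    by (simp add: algebra_simps)
  then have "real n * (real n - 1) * recovery_error \<gamma> rank_by_score n \<le> 2 * (real n * real n) * (\<epsilon> + X)"
    unfolding two_choose_two by simp
  moreover have "real n * (real n / 2) * recovery_error \<gamma> rank_by_score n \<le>
      real n * (real n - 1) * recovery_error \<gamma> rank_by_score n"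
    using n by (intro mult_right_mono mult_left_mono recovery_error_nonneg) auto
  ultimately have "(real n * real n) * recovery_error \<gamma> rank_by_score n \<le> (real n * real n) * (4 * (\<epsilon> + X))"
    by (simp add: algebra_simps)
  moreover have "0 < real n * real n" using n by simp
  ultimately show ?thesis unfolding X_def[symmetric] using mult_le_cancel_left_pos by blast
qed

lemma strong_recovery_rank_by_score:
  assumes \<gamma>: "\<And>n. 0 \<le> \<gamma> n" "\<And>n. \<gamma> n \<le> 1 / 4"
    and \<omega>: "\<gamma> \<in> \<omega>(\<lambda>n. real n powr (- 1 / 2))"
  shows "strong_recovery \<gamma> rank_by_score"
  unfolding strong_recovery_def
proof (rule LIMSEQ_I)
  fix r :: real assume r: "0 < r"
  \<comment> \<open>The final bound is \<open>8 * \<epsilon> = r / 2\<close>.\<close>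
  define \<epsilon> where "\<epsilon> = r / 16"
  have \<epsilon>: "0 < \<epsilon>" using r by (simp add: \<epsilon>_def)
  \<comment> \<open>Gives \<open>\<gamma>\<^sup>2 * n \<ge> 1 / \<epsilon> ^ 3\<close>, so that the
    second error term is at most \<open>\<epsilon>\<close>.\<close>
  define C where "C = 1 / sqrt (\<epsilon> ^ 3)"
  have C: "0 < C" using \<epsilon> by (simp add: C_def)
  have "\<forall>\<^sub>F n in sequentially. norm (\<gamma> n) \<ge> C * norm (real n powr (- 1 / 2))"
    using landau_omega.smallD[OF \<omega> C] .
  then have "\<forall>\<^sub>F n in sequentially. norm (recovery_error \<gamma> rank_by_score n - 0) < r"
    using eventually_ge_at_top[of 2]
  proof eventually_elim
    case (elim n)
    have "C * real n powr (- 1 / 2) > 0" using C elim(2) by simp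
    with elim(1) \<gamma>(1)[of n] have pos: "0 < \<gamma> n" by simp
    have "(C * real n powr (- 1 / 2))\<^sup>2 \<le> (\<gamma> n)\<^sup>2"
      using elim(1) \<gamma>(1)[of n] C by (intro power_mono) auto
    moreover have "(C * real n powr (- 1 / 2))\<^sup>2 = (1 / \<epsilon> ^ 3) / n"
      using elim(2) \<epsilon> by (simp add: C_def power_mult_distrib power_divide powr_minus powr_half_sqrt field_simps)
    ultimately have "(1 / \<epsilon> ^ 3) / n \<le> (\<gamma> n)\<^sup>2" by simp
    then have "1 / \<epsilon> ^ 3 \<le> (\<gamma> n)\<^sup>2 * n" using elim(2) by (simp only: pos_divide_le_eq)
    then have "1 \<le> \<epsilon> * ((\<gamma> n)\<^sup>2 * n * \<epsilon>\<^sup>2)"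
      using \<epsilon> by (simp add: field_simps power2_eq_square power3_eq_cube)
    then have "1 / ((\<gamma> n)\<^sup>2 * n * \<epsilon>\<^sup>2) \<le> \<epsilon>"
      using pos elim(2) \<epsilon> by (subst pos_divide_le_eq) auto
    moreover have "recovery_error \<gamma> rank_by_score n \<le> 4 * (\<epsilon> + 1 / ((\<gamma> n)\<^sup>2 * n * \<epsilon>\<^sup>2))"
      using \<gamma>(2)[of n] by (intro recovery_error_rank_by_score_le pos elim \<epsilon>) auto
    moreover have "4 * (\<epsilon> + x) \<le> 8 * \<epsilon>" if "x \<le> \<epsilon>" for x using that by simp
    ultimately have "recovery_error \<gamma> rank_by_score n \<le> 8 * \<epsilon>" using order_trans by blast
    then show ?case using recovery_error_nonneg[of \<gamma> rank_by_score n] r by (simp add: \<epsilon>_def)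
  qed
  then show "\<exists>no. \<forall>n\<ge>no. norm (recovery_error \<gamma> rank_by_score n - 0) < r"
    by (simp add: eventually_sequentially)
qed

section \<open>Weak recovery\<close>

locale planted_pair =
  fixes n :: nat and \<gamma> :: real and \<pi> :: "nat \<Rightarrow> nat" and i j :: nat
  assumes perm: "\<pi> permutes {..<n}" and \<gamma>: "0 \<le> \<gamma>" "\<gamma> \<le> 1 / 4"
    and ij: "(i, j) \<in> ordered_pairs n \<pi>"
begin

text \<open>
  Exchanging \<open>i\<close> and \<open>j\<close> in \<open>\<pi>\<close> only reverses the expected outcome of the matches summed up in
  \<open>evidence\<close>, so that the likelihood ratio of the two orders is a function of \<open>evidence\<close>. The rest
  \<open>noise\<close> of the score difference comes from the players that are on the same side of both.
\<close>

definition between :: "nat set" where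
  "between = {k. k < n \<and> \<pi> i < \<pi> k \<and> \<pi> k < \<pi> j}"

definition outside :: "nat set" where
  "outside = {k. k < n \<and> (\<pi> k < \<pi> i \<or> \<pi> j < \<pi> k)}"

definition evidence :: "matrix \<Rightarrow> int" where
  "evidence T = T i j + (\<Sum>k\<in>between. T i k - T j k)"

definition noise :: "matrix \<Rightarrow> int" where
  "noise T = (\<Sum>k\<in>outside. T i k - T j k)"

text \<open>A player before both or after both wins against \<open>i\<close> and against
  \<open>j\<close> with the same probability, so exchanging these results is a symmetry of the law
  under \<open>\<pi>\<close>.\<close>

definition swap_outside :: "matrix \<Rightarrow> matrix" where
  "swap_outside T = (\<lambda>a b. if a \<in> outside \<or> b \<in> outside then T (swap i j a) (swap i j b) else T a b)"

lemma basic: "i < n" "j < n" "i \<noteq> j" "\<pi> i < \<pi> j"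
  using ij by (auto simp: ordered_pairs_def)

lemma \<gamma>_half: "\<gamma> \<le> 1 / 2" using \<gamma> by simp

lemma pi_eq [simp]: "\<pi> a = \<pi> b \<longleftrightarrow> a = b"
  using permutes_inj[OF perm] by (auto simp: inj_def)

lemma finite_sets [simp]: "finite between" "finite outside"
  by (simp_all add: between_def outside_def)

lemma perm_swap: "swap i j permutes {..<n}"
  using basic by (intro permutes_swap_id) auto

lemma perm': "\<pi> \<circ> swap i j permutes {..<n}"
  by (rule permutes_compose[OF perm_swap perm])

text \<open>The match between \<open>i\<close> and \<open>j\<close> enters both scores with opposite
  signs, hence twice in the difference; \<open>evidence\<close> contains it once, which leaves the
  extra \<open>T i j\<close>.\<close>

lemma score_diff:
  assumes T: "T \<in> tournaments n"
  shows "score n T i - score n T j = T i j + evidence T + noise T"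
proof -
  have "{..<n} = insert i (insert j (between \<union> outside))"
    using basic by (auto simp: between_def outside_def not_less le_less)
  moreover have "i \<notin> insert j (between \<union> outside)" "j \<notin> between \<union> outside" "between \<inter> outside = {}"
    using basic by (auto simp: between_def outside_def)
  ultimately have "(\<Sum>k<n. T i k - T j k) = (T i i - T j i) + ((T i j - T j j) +
      ((\<Sum>k\<in>between. T i k - T j k) + (\<Sum>k\<in>outside. T i k - T j k)))"
    by (simp add: sum.union_disjoint)
  moreover have "T i i = 0" "T j j = 0" "T j i = - T i j"
    using tournament_antisym[OF T, of i i] tournament_antisym[OF T, of j j]
      tournament_antisym[OF T, of j i] by auto
  ultimately show ?thesis
    by (simp add: score_def evidence_def noise_def flip: sum_subtractf)
qed

lemma swap_outside_mem:
  "swap i j a \<in> outside \<longleftrightarrow> a \<in> outside"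
  using basic by (auto simp: outside_def Transposition.transpose_def)

lemma swap_outside_tournament:
  assumes T: "T \<in> tournaments n"
  shows "swap_outside T \<in> tournaments n"
proof -
  note R = relabel_tournament[OF perm_swap T]
  have eq: "swap_outside T a b = (if a \<in> outside \<or> b \<in> outside then relabel (swap i j) T a b else T a b)" for a b
    by (simp add: swap_outside_def relabel_def)
  have "swap_outside T a b = - swap_outside T b a" for a b
    using tournament_antisym[OF T, of a b] tournament_antisym[OF R, of a b] by (auto simp: eq)
  moreover have "swap_outside T a b \<in> {-1, 1}" if "a < n" "b < n" "a \<noteq> b" for a b
    using tournament_sign[OF T that] tournament_sign[OF R that] by (auto simp: eq)
  moreover have "swap_outside T a b = 0" if "\<not> (a < n \<and> b < n)" for a b
    using tournament_outside[OF T that] tournament_outside[OF R that] by (auto simp: eq)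
  ultimately show ?thesis unfolding tournaments_def tournament_def mem_Collect_eq by blast
qed

lemma bij_betw_swap_outside: "bij_betw swap_outside (tournaments n) (tournaments n)"
proof (rule bij_betwI[where g = swap_outside])
  show "swap_outside (swap_outside T) = T" for T
    by (intro ext) (simp add: swap_outside_def swap_outside_mem)
  then show "swap_outside (swap_outside T) = T" for T .
qed (use swap_outside_tournament in auto)

lemma likelihood_swap_outside:
  "likelihood n \<gamma> \<pi> (swap_outside T) = likelihood n \<gamma> \<pi> T"
proof -
  define \<theta> where "\<theta> = (\<lambda>(a, b). if a \<in> outside \<or> b \<in> outside then (swap i j a, swap i j b) else (a, b))"
  have \<theta>\<theta>: "\<theta> (\<theta> p) = p" for p
    by (cases p) (auto simp: \<theta>_def swap_outside_mem)
  have "\<theta> p \<in> ordered_pairs n \<pi>" if "p \<in> ordered_pairs n \<pi>" for p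
    using that basic
    by (cases p) (auto simp: \<theta>_def ordered_pairs_def outside_def Transposition.transpose_def)
  then have bij: "bij_betw \<theta> (ordered_pairs n \<pi>) (ordered_pairs n \<pi>)"
    using \<theta>\<theta> by (intro bij_betwI[where g = \<theta>]) auto
  have "swap_outside T (fst p) (snd p) = T (fst (\<theta> p)) (snd (\<theta> p))" for p
    by (cases p) (simp add: swap_outside_def \<theta>_def)
  then show ?thesis
    unfolding likelihood_def case_prod_unfold
    using prod.reindex_bij_betw[OF bij, of "\<lambda>p. 1 / 2 + \<gamma> * T (fst p) (snd p)"] by simp
qed

lemma swap_outside_stats:
  "swap_outside T i j = T i j" "evidence (swap_outside T) = evidence T" "noise (swap_outside T) = - noise T"
proof -
  have o: "i \<notin> outside" "j \<notin> outside" "\<And>k. k \<in> between \<Longrightarrow> k \<notin> outside"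
    "\<And>k. k \<in> outside \<Longrightarrow> swap i j k = k"
    using basic by (auto simp: outside_def between_def Transposition.transpose_def)
  show "swap_outside T i j = T i j" "evidence (swap_outside T) = evidence T"
    by (simp_all add: swap_outside_def evidence_def o)
  show "noise (swap_outside T) = - noise T"
    by (simp add: swap_outside_def noise_def o flip: sum_negf)
qed

lemma relabel_stats:
  assumes T: "T \<in> tournaments n"
  shows "relabel (swap i j) T i j = - T i j" "evidence (relabel (swap i j) T) = - evidence T"
    "noise (relabel (swap i j) T) = - noise T"
proof -
  have o: "\<And>k. k \<in> outside \<Longrightarrow> swap i j k = k" "\<And>k. k \<in> between \<Longrightarrow> swap i j k = k"
    using basic by (auto simp: outside_def between_def Transposition.transpose_def)
  show 1: "relabel (swap i j) T i j = - T i j"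
    using tournament_antisym[OF T, of j i] by (simp add: relabel_def)
  show "evidence (relabel (swap i j) T) = - evidence T"
    unfolding evidence_def 1 by (simp add: relabel_def o sum_subtractf)
  show "noise (relabel (swap i j) T) = - noise T"
    by (simp add: noise_def relabel_def o sum_subtractf)
qed

lemma mean_swap_outside:
  "mean n \<gamma> \<pi> (\<lambda>T. f (swap_outside T)) = mean n \<gamma> \<pi> f"
  unfolding mean_def
  by (subst (2) sum.reindex_bij_betw[OF bij_betw_swap_outside, symmetric])
    (simp add: likelihood_swap_outside)

section \<open>The likelihood ratio as a function of \<open>evidence\<close>\<close>

definition changed :: "(nat \<times> nat) set" where
  "changed = ordered_pairs n \<pi> - ordered_pairs n (\<pi> \<circ> swap i j)"

text \<open>The order of \<open>i\<close> or \<open>j\<close> relative to a third player changes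
  only if that player is between them, and then it changes for both.\<close>

lemma changed_eq:
  "changed = insert (i, j) ((\<lambda>k. (i, k)) ` between \<union> (\<lambda>k. (k, j)) ` between)"
proof -
  have "(a, b) \<in> changed \<longleftrightarrow> a = i \<and> b = j \<or> a = i \<and> b \<in> between \<or> b = j \<and> a \<in> between" for a b
  proof -
    have ne: "\<pi> a < \<pi> c \<or> \<pi> c < \<pi> a" if "a \<noteq> c" for a c
      using that pi_eq[of a c] by linarith
    show ?thesis
      using basic ne[of a i] ne[of b i] ne[of a j] ne[of b j]
      by (cases "a = i"; cases "a = j"; cases "b = i"; cases "b = j")
        (auto simp: changed_def ordered_pairs_def between_def Transposition.transpose_def)
  qed
  then show ?thesis by auto
qed

lemma finite_changed [simp]: "finite changed"
  by (simp add: changed_def)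

text \<open>As \<open>T i k - T j k = T i k + T k j\<close>, the evidence sums the outcomes of
  exactly the reversed pairs.\<close>

lemma sum_changed_pairs:
  assumes T: "T \<in> tournaments n"
  shows "(\<Sum>p\<in>changed. T (fst p) (snd p)) = evidence T"
proof -
  have "(i, j) \<notin> (\<lambda>k. (i, k)) ` between \<union> (\<lambda>k. (k, j)) ` between"
    "(\<lambda>k. (i, k)) ` between \<inter> (\<lambda>k. (k, j)) ` between = {}"
    using basic by (auto simp: between_def)
  then have "(\<Sum>p\<in>changed. T (fst p) (snd p)) =
      T i j + ((\<Sum>k\<in>between. T i k) + (\<Sum>k\<in>between. T k j))"
    unfolding changed_eq by (simp add: sum.union_disjoint sum.reindex inj_on_def)
  also have "(\<Sum>k\<in>between. T k j) = (\<Sum>k\<in>between. - T j k)"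
    by (intro sum.cong refl tournament_antisym[OF T])
  finally show ?thesis by (simp add: evidence_def sum_subtractf sum_negf)
qed

text \<open>Exponential family form: \<open>1 / 2 + \<gamma> = exp (\<mu> + l)\<close> and
  \<open>1 / 2 - \<gamma> = exp (\<mu> - l)\<close>. The unchanged pairs and the powers of
  \<open>exp \<mu>\<close> are common to both laws and go into \<open>K\<close>. The bound on
  \<open>l\<close> uses \<open>ln z \<le> z - 1\<close> and
  \<open>\<gamma> \<le> 1 / 4\<close>.\<close>

lemma likelihood_exp:
  obtains K l where "0 \<le> l" "l \<le> 4 * \<gamma>"
    "\<And>T. T \<in> tournaments n \<Longrightarrow> 0 \<le> K T"
    "\<And>T. T \<in> tournaments n \<Longrightarrow> likelihood n \<gamma> \<pi> T = K T * exp (l * evidence T)"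
    "\<And>T. T \<in> tournaments n \<Longrightarrow> likelihood n \<gamma> (\<pi> \<circ> swap i j) T = K T * exp (- (l * evidence T))"
proof -
  define x y where "x = ln (1 / 2 + \<gamma>)" and "y = ln (1 / 2 - \<gamma>)"
  define l \<mu> where "l = (x - y) / 2" and "\<mu> = (x + y) / 2"
  let ?P = "ordered_pairs n \<pi>"
  define K where "K T = (\<Prod>p\<in>?P - changed. 1 / 2 + \<gamma> * T (fst p) (snd p)) * exp (\<mu>) ^ card changed"
    for T :: matrix
  have ex: "1 / 2 + \<gamma> = exp (\<mu> + l)" "1 / 2 - \<gamma> = exp (\<mu> - l)"
    using \<gamma> by (simp_all add: l_def \<mu>_def x_def y_def field_simps)
  have "y \<le> x" using \<gamma> unfolding x_def y_def by simp
  then have l0: "0 \<le> l" by (simp add: l_def)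
  have "x - y = ln ((1 / 2 + \<gamma>) / (1 / 2 - \<gamma>))"
    unfolding x_def y_def using \<gamma> by (subst ln_div) auto
  also have "\<dots> \<le> (1 / 2 + \<gamma>) / (1 / 2 - \<gamma>) - 1"
    using \<gamma> by (intro ln_le_minus_one) auto
  also have "\<dots> \<le> 8 * \<gamma>"
  proof -
    have "0 \<le> \<gamma> * (1 / 4 - \<gamma>)" using \<gamma> by simp
    then have "1 / 2 + \<gamma> \<le> (8 * \<gamma> + 1) * (1 / 2 - \<gamma>)" by (simp add: algebra_simps)
    then have "(1 / 2 + \<gamma>) / (1 / 2 - \<gamma>) \<le> 8 * \<gamma> + 1" using \<gamma> by (subst pos_divide_le_eq) auto
    then show ?thesis by simp
  qed
  finally have l1: "l \<le> 4 * \<gamma>" by (simp add: l_def)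
  have prod_exp: "(\<Prod>p\<in>changed. exp (\<mu> + s * l * T (fst p) (snd p))) =
      exp \<mu> ^ card changed * exp (s * (l * evidence T))" if T: "T \<in> tournaments n" for s :: real and T
  proof -
    have "(\<Prod>p\<in>changed. exp (\<mu> + s * l * T (fst p) (snd p))) =
        exp (\<Sum>p\<in>changed. \<mu> + s * l * T (fst p) (snd p))"
      by (simp add: exp_sum)
    also have "(\<Sum>p\<in>changed. \<mu> + s * l * T (fst p) (snd p)) = card changed * \<mu> + s * (l * evidence T)"
      by (simp add: sum.distrib sum_changed_pairs[OF T, symmetric] sum_distrib_left mult.assoc)
    finally show ?thesis by (simp add: exp_add exp_of_nat_mult)
  qed
  have split: "(\<Prod>p\<in>?P. f p) = (\<Prod>p\<in>?P - changed. f p) * (\<Prod>p\<in>changed. f p)" for f :: "nat \<times> nat \<Rightarrow> real"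
    by (rule prod.subset_diff) (auto simp: changed_def)
  show thesis
  proof (rule that[OF l0 l1, of K])
    fix T assume T: "T \<in> tournaments n"
    have sg: "T (fst p) (snd p) \<in> {-1, 1}" if "p \<in> ?P" for p
      using tournament_sign_ordered[OF T that] .
    have "0 \<le> (\<Prod>p\<in>?P - changed. 1 / 2 + \<gamma> * T (fst p) (snd p))"
    proof (rule prod_nonneg)
      fix p assume "p \<in> ?P - changed"
      with sg[of p] \<gamma> show "0 \<le> 1 / 2 + \<gamma> * T (fst p) (snd p)" by auto
    qed
    then show "0 \<le> K T" by (simp add: K_def)
    have "(\<Prod>p\<in>changed. 1 / 2 + \<gamma> * T (fst p) (snd p)) =
        (\<Prod>p\<in>changed. exp (\<mu> + 1 * l * T (fst p) (snd p)))"
    proof (rule prod.cong[OF refl])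
      fix p assume "p \<in> changed"
      then have "p \<in> ?P" by (simp add: changed_def)
      with sg[of p] ex show "1 / 2 + \<gamma> * T (fst p) (snd p) = exp (\<mu> + 1 * l * T (fst p) (snd p))" by auto
    qed
    then show "likelihood n \<gamma> \<pi> T = K T * exp (l * evidence T)"
      unfolding likelihood_def case_prod_unfold split prod_exp[OF T] by (simp add: K_def)
    have "(\<Prod>p\<in>changed. 1 / 2 - \<gamma> * T (fst p) (snd p)) =
        (\<Prod>p\<in>changed. exp (\<mu> + (-1) * l * T (fst p) (snd p)))"
    proof (rule prod.cong[OF refl])
      fix p assume "p \<in> changed"
      then have "p \<in> ?P" by (simp add: changed_def)
      with sg[of p] ex show "1 / 2 - \<gamma> * T (fst p) (snd p) = exp (\<mu> + (-1) * l * T (fst p) (snd p))" by auto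
    qed
    moreover have "likelihood n \<gamma> (\<pi> \<circ> swap i j) T =
        (\<Prod>p\<in>?P - changed. 1 / 2 + \<gamma> * T (fst p) (snd p)) * (\<Prod>p\<in>changed. 1 / 2 - \<gamma> * T (fst p) (snd p))"
      unfolding likelihood_other[OF perm perm' T] split
      by (intro arg_cong2[of _ _ _ _ "(*)"] prod.cong) (auto simp: changed_def)
    ultimately show "likelihood n \<gamma> (\<pi> \<circ> swap i j) T = K T * exp (- (l * evidence T))"
      unfolding prod_exp[OF T] by (simp add: K_def)
  qed
qed

text \<open>The first two claims make the sign of \<open>evidence\<close> the likelihood ratio test.
  By the third, a small \<open>evidence\<close> hardly separates the laws, so that a wrong decision
  there costs little; \<open>8 * \<gamma>\<close> bounds \<open>2 * l\<close>.\<close>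

lemma likelihood_compare:
  assumes T: "T \<in> tournaments n"
  defines "w \<equiv> likelihood n \<gamma> \<pi> T" and "v \<equiv> likelihood n \<gamma> (\<pi> \<circ> swap i j) T"
  shows "0 \<le> evidence T \<Longrightarrow> v \<le> w" "evidence T \<le> 0 \<Longrightarrow> w \<le> v"
    "\<bar>w - v\<bar> \<le> 8 * \<gamma> * \<bar>real_of_int (evidence T)\<bar> * (w + v)"
proof -
  from likelihood_exp obtain K l where l: "0 \<le> l" "l \<le> 4 * \<gamma>" and K: "0 \<le> K T"
    and wv: "w = K T * exp (l * evidence T)" "v = K T * exp (- (l * evidence T))"
    unfolding w_def v_def using T by metis
  show "v \<le> w" if "0 \<le> evidence T"
  proof -
    have "- (l * evidence T) \<le> l * evidence T" using that l by simp
    then show ?thesis unfolding wv using K by (intro mult_left_mono) auto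
  qed
  show "w \<le> v" if "evidence T \<le> 0"
  proof -
    have "l * evidence T \<le> - (l * evidence T)" using that l by (simp add: mult_nonneg_nonpos)
    then show ?thesis unfolding wv using K by (intro mult_left_mono) auto
  qed
  have key: "\<bar>exp t - exp (- t)\<bar> \<le> 2 * \<bar>t\<bar> * (exp t + exp (- t))" for t :: real
  proof -
    have *: "exp t - exp (- t) \<le> 2 * t * (exp t + exp (- t))" if "0 \<le> t" for t :: real
    proof -
      \<comment> \<open>Factors out \<open>exp t\<close> and uses
        \<open>1 - exp (- u) \<le> u\<close> at \<open>u = 2 * t\<close>.\<close>
      have "exp t * (1 - exp (- (2 * t))) \<le> exp t * (2 * t)"
        using exp_ge_add_one_self[of "- (2 * t)"] by (intro mult_left_mono) auto
      moreover have "exp t * exp (- (2 * t)) = exp (- t)" by (simp flip: exp_add)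
      moreover have "0 \<le> 2 * t * exp (- t)" using that by simp
      ultimately show ?thesis by (simp add: algebra_simps)
    qed
    show ?thesis
    proof (cases "0 \<le> t")
      case True
      then have "exp (- t) \<le> exp t" by simp
      with *[OF True] True show ?thesis by simp
    next
      case False
      then have "exp t \<le> exp (- t)" by simp
      with *[of "- t"] False show ?thesis by (simp add: add.commute)
    qed
  qed
  have "\<bar>w - v\<bar> = K T * \<bar>exp (l * evidence T) - exp (- (l * evidence T))\<bar>"
    unfolding wv using K by (simp flip: right_diff_distrib add: abs_mult)
  also have "\<dots> \<le> K T * (2 * \<bar>l * evidence T\<bar> * (exp (l * evidence T) + exp (- (l * evidence T))))"
    using K by (intro mult_left_mono key)
  also have "\<dots> = 2 * l * \<bar>real_of_int (evidence T)\<bar> * (w + v)"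
    unfolding wv using l by (simp add: abs_mult algebra_simps)
  also have "\<dots> \<le> 8 * \<gamma> * \<bar>real_of_int (evidence T)\<bar> * (w + v)"
    using l K unfolding wv by (intro mult_right_mono) auto
  finally show "\<bar>w - v\<bar> \<le> 8 * \<gamma> * \<bar>real_of_int (evidence T)\<bar> * (w + v)" .
qed

text \<open>
  Averaging the sign of the score difference over \<open>swap_outside\<close>, which flips \<open>noise\<close> and preserves
  the likelihood, gives half of \<open>vote\<close>. It never has the opposite sign of \<open>evidence\<close>.
\<close>

definition vote :: "matrix \<Rightarrow> real" where
  "vote T = sgn (real_of_int (T i j + evidence T + noise T)) + sgn (real_of_int (T i j + evidence T - noise T))"

text \<open>Two doublings: averaging over \<open>swap_outside\<close> makes the mean of
  \<open>vote\<close> twice that of the sign, and \<open>vote\<close> is odd under the exchange of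
  \<open>i\<close> and \<open>j\<close>, so its means under the two laws are opposite.\<close>

lemma four_mean_sgn:
  "4 * mean n \<gamma> \<pi> (\<lambda>T. sgn (real_of_int (score n T i - score n T j))) =
   (\<Sum>T\<in>tournaments n. (likelihood n \<gamma> \<pi> T - likelihood n \<gamma> (\<pi> \<circ> swap i j) T) * vote T)"
proof -
  let ?s = "\<lambda>T. sgn (real_of_int (T i j + evidence T + noise T))"
  have "mean n \<gamma> \<pi> (\<lambda>T. sgn (real_of_int (score n T i - score n T j))) = mean n \<gamma> \<pi> ?s"
    by (intro mean_cong) (simp only: score_diff)
  moreover have "mean n \<gamma> \<pi> vote = mean n \<gamma> \<pi> ?s + mean n \<gamma> \<pi> (\<lambda>T. ?s (swap_outside T))"
    unfolding mean_add[symmetric] by (intro mean_cong) (simp add: vote_def swap_outside_stats)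
  moreover have "mean n \<gamma> (\<pi> \<circ> swap i j) vote = mean n \<gamma> \<pi> (\<lambda>T. (-1) * vote T)"
  proof -
    have neg: "vote (relabel (swap i j) T) = (-1) * vote T" if "T \<in> tournaments n" for T
    proof -
      define x y where "x = real_of_int (T i j + evidence T)" and "y = real_of_int (noise T)"
      have "vote T = sgn (x + y) + sgn (x - y)" by (simp add: vote_def x_def y_def)
      moreover have "vote (relabel (swap i j) T) = sgn (- (x + y)) + sgn (- (x - y))"
        unfolding vote_def relabel_stats[OF that] x_def y_def
        by (intro arg_cong2[of _ _ _ _ "(+)"] arg_cong[of _ _ sgn]) simp_all
      ultimately show ?thesis unfolding sgn_minus by simp
    qed
    show ?thesis unfolding mean_relabel[OF perm_swap] by (intro mean_cong neg)
  qed
  moreover have "mean n \<gamma> \<pi> (\<lambda>T. ?s (swap_outside T)) = mean n \<gamma> \<pi> ?s"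
    by (rule mean_swap_outside)
  moreover have "mean n \<gamma> \<pi> (\<lambda>T. (-1) * vote T) = (-1) * mean n \<gamma> \<pi> vote"
    by (rule mean_cmult)
  moreover have "(\<Sum>T\<in>tournaments n. (likelihood n \<gamma> \<pi> T - likelihood n \<gamma> (\<pi> \<circ> swap i j) T) * vote T) =
      mean n \<gamma> \<pi> vote - mean n \<gamma> (\<pi> \<circ> swap i j) vote"
    by (simp add: mean_def left_diff_distrib sum_subtractf)
  ultimately show ?thesis by linarith
qed

lemma likelihood_vote_nonneg:
  assumes T: "T \<in> tournaments n"
  shows "0 \<le> (likelihood n \<gamma> \<pi> T - likelihood n \<gamma> (\<pi> \<circ> swap i j) T) * vote T"
proof -
  have t: "T i j \<in> {-1, 1}" using tournament_sign[OF T basic(1-3)] .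
  consider "evidence T > 0" | "evidence T = 0" | "evidence T < 0" by linarith
  then show ?thesis
  proof cases
    case 1
    \<comment> \<open>The evidence is an integer, so adding the sign \<open>T i j\<close> leaves it
      nonnegative; and \<open>sgn (x + y) + sgn (x - y) \<ge> 0\<close> for
      \<open>x \<ge> 0\<close>.\<close>
    then have "0 \<le> vote T" using t by (auto simp: vote_def sgn_if)
    with 1 likelihood_compare(1)[OF T] show ?thesis by simp
  next
    case 2
    with likelihood_compare(1,2)[OF T] show ?thesis by simp
  next
    case 3
    then have "vote T \<le> 0" using t by (auto simp: vote_def sgn_if)
    with 3 likelihood_compare(2)[OF T] show ?thesis by (simp add: mult_nonpos_nonpos)
  qed
qed

text \<open>No pair is ranked worse than by guessing, so pairs without a better bound can be left
  out of the average.\<close>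

lemma mean_sgn_nonneg: "0 \<le> mean n \<gamma> \<pi> (\<lambda>T. sgn (real_of_int (score n T i - score n T j)))"
proof -
  have "0 \<le> 4 * mean n \<gamma> \<pi> (\<lambda>T. sgn (real_of_int (score n T i - score n T j)))"
    unfolding four_mean_sgn by (intro sum_nonneg likelihood_vote_nonneg)
  then show ?thesis by simp
qed

text \<open>
  Unless \<open>noise\<close> dominates \<open>evidence\<close> up to \<open>1\<close>, which accounts for the error term, \<open>vote\<close> is \<open>2\<close>
  times the sign of the likelihood difference. Truncating \<open>evidence\<close> at \<open>R\<close> makes its first two
  moments suffice.
\<close>

lemma likelihood_vote_ge:
  fixes w v R :: real
  assumes T: "T \<in> tournaments n" and R: "0 < R"
  defines "w \<equiv> likelihood n \<gamma> \<pi> T" and "v \<equiv> likelihood n \<gamma> (\<pi> \<circ> swap i j) T"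
  shows "2 / R * ((w - v) * evidence T - (w + v) * ((real_of_int (evidence T))\<^sup>2 / R)) -
    16 * \<gamma> * ((w + v) * (\<bar>noise T\<bar> + 1)) \<le> (w - v) * vote T"
proof -
  define a where "a = real_of_int (evidence T)"
  have t: "T i j \<in> {-1, 1}" using tournament_sign[OF T basic(1-3)] .
  have wv: "0 \<le> w" "0 \<le> v" unfolding w_def v_def
    by (intro likelihood_nonneg[OF \<gamma>(1) \<gamma>_half T])+
  have abs: "\<bar>w - v\<bar> \<le> w + v" using wv by linarith
  \<comment> \<open>Up to \<open>R\<close> the first term alone is at most
    \<open>R * \<bar>w - v\<bar>\<close>; beyond \<open>R\<close> the quadratic term dominates since
    \<open>\<bar>a\<bar> \<le> a\<^sup>2 / R\<close>.\<close>
  have "(w - v) * a - (w + v) * (a\<^sup>2 / R) \<le> R * \<bar>w - v\<bar>"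
  proof (cases "\<bar>a\<bar> \<le> R")
    case True
    have "(w - v) * a \<le> \<bar>w - v\<bar> * \<bar>a\<bar>" by (metis abs_ge_self abs_mult)
    also have "\<dots> \<le> \<bar>w - v\<bar> * R" using True by (intro mult_left_mono) auto
    moreover have "0 \<le> (w + v) * (a\<^sup>2 / R)" using wv R by simp
    ultimately show ?thesis by (simp add: mult.commute)
  next
    case False
    have "(w - v) * a \<le> \<bar>w - v\<bar> * \<bar>a\<bar>" by (metis abs_ge_self abs_mult)
    also have "\<dots> \<le> (w + v) * (a\<^sup>2 / R)"
    proof (intro mult_mono abs)
      have "\<bar>a\<bar> * R \<le> \<bar>a\<bar> * \<bar>a\<bar>" using False by (intro mult_left_mono) auto
      then show "\<bar>a\<bar> \<le> a\<^sup>2 / R" using R by (simp add: pos_le_divide_eq power2_eq_square)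
    qed (use wv in auto)
    finally have "(w - v) * a \<le> (w + v) * (a\<^sup>2 / R)" .
    moreover have "0 \<le> R * \<bar>w - v\<bar>" using R by simp
    ultimately show ?thesis by linarith
  qed
  then have "2 / R * ((w - v) * a - (w + v) * (a\<^sup>2 / R)) \<le> 2 / R * (R * \<bar>w - v\<bar>)"
    using R by (intro mult_left_mono) auto
  then have 1: "2 / R * ((w - v) * a - (w + v) * (a\<^sup>2 / R)) \<le> 2 * \<bar>w - v\<bar>" using R by simp
  \<comment> \<open>If the noise prevails, \<open>\<bar>w - v\<bar>\<close> itself is small, and the
    nonnegative right-hand side suffices. Otherwise both terms of \<open>vote\<close> have the sign
    of \<open>T i j + evidence T\<close> and nothing is lost.\<close>
  have 2: "2 * \<bar>w - v\<bar> - 16 * \<gamma> * ((w + v) * (\<bar>noise T\<bar> + 1)) \<le> (w - v) * vote T"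
  proof (cases "\<bar>T i j + evidence T\<bar> \<le> \<bar>noise T\<bar>")
    case True
    have "\<bar>evidence T\<bar> \<le> \<bar>noise T\<bar> + 1" using True t by auto
    then have "\<bar>a\<bar> \<le> \<bar>noise T\<bar> + 1" unfolding a_def by linarith
    then have "8 * \<gamma> * \<bar>a\<bar> * (w + v) \<le> 8 * \<gamma> * (\<bar>noise T\<bar> + 1) * (w + v)"
      using \<gamma> wv by (intro mult_right_mono mult_left_mono) auto
    with likelihood_compare(3)[OF T]
    have "\<bar>w - v\<bar> \<le> 8 * \<gamma> * (\<bar>noise T\<bar> + 1) * (w + v)" unfolding w_def v_def a_def by linarith
    then have "2 * \<bar>w - v\<bar> \<le> 2 * (8 * \<gamma> * (\<bar>noise T\<bar> + 1) * (w + v))"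
      by (intro mult_left_mono) auto
    also have "\<dots> = 16 * \<gamma> * ((w + v) * (\<bar>noise T\<bar> + 1))"
      by simp
    finally have "2 * \<bar>w - v\<bar> \<le> 16 * \<gamma> * ((w + v) * (\<bar>noise T\<bar> + 1))" .
    moreover have "0 \<le> (w - v) * vote T"
      unfolding w_def v_def by (rule likelihood_vote_nonneg[OF T])
    ultimately show ?thesis by linarith
  next
    case False
    have "(w - v) * vote T = 2 * \<bar>w - v\<bar>"
    proof (cases "T i j + evidence T > 0")
      case True
      with False t have "0 \<le> evidence T" "vote T = 2" by (auto simp: vote_def sgn_if)
      with likelihood_compare(1)[OF T] show ?thesis unfolding w_def v_def by simp
    next
      case neg: False
      with False have "vote T = -2" "T i j + evidence T < 0" by (auto simp: vote_def sgn_if)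
      with t have "evidence T \<le> 0" by auto
      with likelihood_compare(2)[OF T] \<open>vote T = -2\<close> show ?thesis unfolding w_def v_def by simp
    qed
    then show ?thesis using \<gamma> wv by simp
  qed
  from 1 2 show ?thesis unfolding a_def by linarith
qed

text \<open>Under the exchange \<open>evidence\<close> is odd, while its square and the modulus of
  \<open>noise\<close> are even. Both laws thus contribute equally, and summing the pointwise bounds
  gives four times the claim.\<close>

lemma mean_sgn_ge:
  assumes R: "0 < R"
  shows "(mean n \<gamma> \<pi> evidence - mean n \<gamma> \<pi> (\<lambda>T. (real_of_int (evidence T))\<^sup>2) / R) / R -
    8 * \<gamma> * (mean n \<gamma> \<pi> (\<lambda>T. \<bar>noise T\<bar>) + 1) \<le>
    mean n \<gamma> \<pi> (\<lambda>T. sgn (real_of_int (score n T i - score n T j)))"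
proof -
  let ?w = "likelihood n \<gamma> \<pi>" and ?v = "likelihood n \<gamma> (\<pi> \<circ> swap i j)"
  note rel = mean_relabel[OF perm_swap, of \<gamma> \<pi>]
  have e: "mean n \<gamma> (\<pi> \<circ> swap i j) evidence = - mean n \<gamma> \<pi> evidence"
  proof -
    have "mean n \<gamma> (\<pi> \<circ> swap i j) evidence = mean n \<gamma> \<pi> (\<lambda>T. (-1) * real_of_int (evidence T))"
      unfolding rel by (intro mean_cong) (simp add: relabel_stats)
    then show ?thesis unfolding mean_cmult by simp
  qed
  have e2: "mean n \<gamma> (\<pi> \<circ> swap i j) (\<lambda>T. (real_of_int (evidence T))\<^sup>2 / R) = mean n \<gamma> \<pi> (\<lambda>T. (real_of_int (evidence T))\<^sup>2 / R)"
    unfolding rel by (intro mean_cong) (simp add: relabel_stats)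
  have e2R: "mean n \<gamma> \<pi> (\<lambda>T. (real_of_int (evidence T))\<^sup>2 / R) = mean n \<gamma> \<pi> (\<lambda>T. (real_of_int (evidence T))\<^sup>2) / R"
    using mean_cmult[of n \<gamma> \<pi> "1 / R" "\<lambda>T. (real_of_int (evidence T))\<^sup>2"] by simp
  have nz: "mean n \<gamma> (\<pi> \<circ> swap i j) (\<lambda>T. \<bar>noise T\<bar> + 1) = mean n \<gamma> \<pi> (\<lambda>T. \<bar>noise T\<bar> + 1)"
    unfolding rel by (intro mean_cong) (simp add: relabel_stats)
  have nz1: "mean n \<gamma> \<pi> (\<lambda>T. \<bar>noise T\<bar> + 1) = mean n \<gamma> \<pi> (\<lambda>T. \<bar>noise T\<bar>) + 1"
    using mean_add[of n \<gamma> \<pi> "\<lambda>T. \<bar>noise T\<bar>" "\<lambda>_. 1"] by (simp add: mean_const[OF perm])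
  have "2 / R * ((mean n \<gamma> \<pi> evidence - mean n \<gamma> (\<pi> \<circ> swap i j) evidence) -
      (mean n \<gamma> \<pi> (\<lambda>T. (real_of_int (evidence T))\<^sup>2 / R) + mean n \<gamma> (\<pi> \<circ> swap i j) (\<lambda>T. (real_of_int (evidence T))\<^sup>2 / R))) -
      16 * \<gamma> * (mean n \<gamma> \<pi> (\<lambda>T. \<bar>noise T\<bar> + 1) + mean n \<gamma> (\<pi> \<circ> swap i j) (\<lambda>T. \<bar>noise T\<bar> + 1)) =
      (\<Sum>T\<in>tournaments n. 2 / R * ((?w T - ?v T) * evidence T - (?w T + ?v T) * ((real_of_int (evidence T))\<^sup>2 / R)) -
        16 * \<gamma> * ((?w T + ?v T) * (\<bar>noise T\<bar> + 1)))"
    unfolding mean_def sum_subtractf[symmetric] sum.distrib[symmetric] sum_distrib_left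
    by (intro sum.cong refl) (simp add: algebra_simps)
  also have "\<dots> \<le> (\<Sum>T\<in>tournaments n. (?w T - ?v T) * vote T)"
    by (intro sum_mono likelihood_vote_ge R)
  also have "\<dots> = 4 * mean n \<gamma> \<pi> (\<lambda>T. sgn (real_of_int (score n T i - score n T j)))"
    by (rule four_mean_sgn[symmetric])
  finally show ?thesis
    unfolding e e2 e2R nz nz1 by (simp add: diff_divide_distrib algebra_simps)
qed

section \<open>Sizes of the sets and moments of \<open>evidence\<close> and
  \<open>noise\<close>\<close>

lemma card_between: "card between = \<pi> j - \<pi> i - 1"
proof -
  have "\<pi> ` between = {\<pi> i<..<\<pi> j}"
  proof
    show "{\<pi> i<..<\<pi> j} \<subseteq> \<pi> ` between"
    proof
      fix y assume y: "y \<in> {\<pi> i<..<\<pi> j}"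
      have "\<pi> j < n" using permutes_in_image[OF perm, of j] basic by simp
      with y have "y < n" by simp
      then have "inv \<pi> y < n" using permutes_in_image[OF permutes_inv[OF perm], of y] by simp
      with y have "inv \<pi> y \<in> between" by (simp add: between_def permutes_inverses[OF perm])
      then show "y \<in> \<pi> ` between" using permutes_inverses(1)[OF perm, of y] by (metis imageI)
    qed
  qed (auto simp: between_def)
  moreover have "inj_on \<pi> between" by (auto simp: inj_on_def)
  ultimately have "card between = card {\<pi> i<..<\<pi> j}" by (metis card_image)
  then show ?thesis by simp
qed

lemma card_outside: "card outside + card between + 2 = n"
proof -
  have "{..<n} = insert i (insert j (between \<union> outside))"
    using basic by (auto simp: between_def outside_def not_less le_less)
  moreover have "i \<notin> insert j (between \<union> outside)" "j \<notin> between \<union> outside" "between \<inter> outside = {}"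
    using basic by (auto simp: between_def outside_def)
  ultimately have "card {..<n} = Suc (Suc (card between + card outside))"
    by (simp add: card_Un_disjoint)
  then show ?thesis by simp
qed

lemma card_changed: "card changed = 2 * card between + 1"
proof -
  have "(i, j) \<notin> (\<lambda>k. (i, k)) ` between \<union> (\<lambda>k. (k, j)) ` between"
    "(\<lambda>k. (i, k)) ` between \<inter> (\<lambda>k. (k, j)) ` between = {}"
    using basic by (auto simp: between_def)
  then show ?thesis
    unfolding changed_eq by (simp add: card_Un_disjoint card_image inj_on_def)
qed

lemma evidence_linear:
  assumes "T \<in> tournaments n"
  shows "real_of_int (evidence T) = (\<Sum>p\<in>ordered_pairs n \<pi>. (of_bool (p \<in> changed) :: real) * T (fst p) (snd p))"
proof -
  have sub: "changed \<subseteq> ordered_pairs n \<pi>" by (auto simp: changed_def)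
  have "real_of_int (evidence T) = (\<Sum>p\<in>changed. (of_bool (p \<in> changed) :: real) * T (fst p) (snd p))"
    by (simp add: sum_changed_pairs[OF assms, symmetric])
  also have "\<dots> = (\<Sum>p\<in>ordered_pairs n \<pi>. (of_bool (p \<in> changed) :: real) * T (fst p) (snd p))"
    using sub by (intro sum.mono_neutral_left) auto
  finally show ?thesis .
qed

lemma sum_of_bool_changed: "(\<Sum>p\<in>ordered_pairs n \<pi>. of_bool (p \<in> changed)) = real (card changed)"
proof -
  have "ordered_pairs n \<pi> \<inter> changed = changed" by (auto simp: changed_def)
  then show ?thesis by (simp only: sum_of_bool_mem finite_ordered_pairs)
qed

lemma mean_evidence: "mean n \<gamma> \<pi> evidence = 2 * \<gamma> * card changed"
proof -
  have "mean n \<gamma> \<pi> evidence =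
      mean n \<gamma> \<pi> (\<lambda>T. \<Sum>p\<in>ordered_pairs n \<pi>. (of_bool (p \<in> changed) :: real) * T (fst p) (snd p))"
    by (intro mean_cong evidence_linear)
  then show ?thesis unfolding mean_linear[OF perm] sum_of_bool_changed .
qed

lemma mean_evidence_sq_le:
  "mean n \<gamma> \<pi> (\<lambda>T. (real_of_int (evidence T))\<^sup>2) \<le> (2 * \<gamma> * card changed)\<^sup>2 + card changed"
proof -
  have "mean n \<gamma> \<pi> (\<lambda>T. (real_of_int (evidence T) - 2 * \<gamma> * card changed)\<^sup>2) =
      mean n \<gamma> \<pi> (\<lambda>T. (\<Sum>p\<in>ordered_pairs n \<pi>. (of_bool (p \<in> changed) :: real) * (T (fst p) (snd p) - 2 * \<gamma>))\<^sup>2)"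
    unfolding sum_of_bool_changed[symmetric]
    by (intro mean_cong) (simp only: evidence_linear right_diff_distrib sum_subtractf
        sum_distrib_left mult.commute mult.left_commute)
  also have "\<dots> = (1 - 4 * \<gamma>\<^sup>2) * (\<Sum>p\<in>ordered_pairs n \<pi>. (of_bool (p \<in> changed))\<^sup>2)"
    by (rule mean_linear_centered_sq[OF perm])
  also have "(\<Sum>p\<in>ordered_pairs n \<pi>. (of_bool (p \<in> changed))\<^sup>2) = real (card changed)"
    unfolding sum_of_bool_changed[symmetric] by (intro sum.cong refl) (simp add: of_bool_def)
  also have "(1 - 4 * \<gamma>\<^sup>2) * real (card changed) \<le> 1 * real (card changed)"
    by (intro mult_right_mono) auto
  finally show ?thesis
    using mean_square[OF perm, of \<gamma> "\<lambda>T. real_of_int (evidence T)"] by (simp add: mean_evidence)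
qed

text \<open>\<open>noise\<close> is centred because \<open>swap_outside\<close> negates it and
  preserves the law. Its second moment is therefore a variance, at most the number of entries
  involved, and the first absolute moment is at most the root of it.\<close>

lemma mean_abs_noise_le: "mean n \<gamma> \<pi> (\<lambda>T. \<bar>noise T\<bar>) \<le> 2 * sqrt (card outside)"
proof -
  let ?e = "\<lambda>a b. score_coeff i j a * of_bool (b \<in> outside)"
  let ?S = "{i, j} \<times> outside \<union> outside \<times> {i, j}"
  have form: "real_of_int (noise T) = form n ?e T" for T
  proof -
    have sub: "{..<n} \<inter> outside = outside" by (auto simp: outside_def)
    have "form n ?e T = (\<Sum>a<n. score_coeff i j a * (\<Sum>b\<in>outside. T a b))"
      unfolding form_def by (simp add: mult.assoc sub flip: sum_distrib_left)
    also have "\<dots> = (\<Sum>a<n. of_bool (a = i) * (\<Sum>b\<in>outside. T a b)) - (\<Sum>a<n. of_bool (a = j) * (\<Sum>b\<in>outside. T a b))"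
      by (simp add: score_coeff_def left_diff_distrib sum_subtractf)
    also have "\<dots> = real_of_int (noise T)"
      using basic by (simp add: noise_def sum_subtractf)
    finally show ?thesis ..
  qed
  have zero: "mean n \<gamma> \<pi> (form n ?e) = 0"
  proof -
    have "mean n \<gamma> \<pi> noise = mean n \<gamma> \<pi> (\<lambda>T. (-1) * real_of_int (noise T))"
      by (subst mean_swap_outside[symmetric]) (simp add: swap_outside_stats)
    then have "mean n \<gamma> \<pi> noise = 0" unfolding mean_cmult by simp
    then show ?thesis unfolding form .
  qed
  have "(mean n \<gamma> \<pi> (\<lambda>T. \<bar>noise T\<bar>))\<^sup>2 \<le> mean n \<gamma> \<pi> (\<lambda>T. (real_of_int \<bar>noise T\<bar>)\<^sup>2)"
    by (rule mean_sq_le[OF \<gamma>(1) \<gamma>_half perm])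
  also have "\<dots> = mean n \<gamma> \<pi> (\<lambda>T. (form n ?e T - mean n \<gamma> \<pi> (form n ?e))\<^sup>2)"
    unfolding zero form[symmetric] by simp
  also have "\<dots> \<le> (\<Sum>(a, b)\<in>ordered_pairs n \<pi>. (?e a b - ?e b a)\<^sup>2)"
    by (rule variance_form_le[OF perm])
  also have "\<dots> \<le> (\<Sum>(a, b)\<in>ordered_pairs n \<pi>. of_bool ((a, b) \<in> ?S))"
    using basic by (intro sum_mono) (auto simp: score_coeff_def outside_def)
  also have "\<dots> = (\<Sum>p\<in>ordered_pairs n \<pi>. of_bool (p \<in> ?S))"
    by (simp only: case_prod_unfold prod.collapse)
  also have "\<dots> = real (card (ordered_pairs n \<pi> \<inter> ?S))"
    by (rule sum_of_bool_mem) simp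
  also have "card (ordered_pairs n \<pi> \<inter> ?S) \<le> card ?S"
    by (rule card_mono) auto
  also have "card ?S \<le> card ({i, j} \<times> outside) + card (outside \<times> {i, j})"
    by (rule card_Un_le)
  also have "\<dots> \<le> 2 * card outside + card outside * 2"
    unfolding card_cartesian_product by (intro add_mono mult_mono) (auto simp: card_insert_if)
  finally have "(mean n \<gamma> \<pi> (\<lambda>T. \<bar>noise T\<bar>))\<^sup>2 \<le> 4 * real (card outside)" by simp
  then have "mean n \<gamma> \<pi> (\<lambda>T. \<bar>noise T\<bar>) \<le> sqrt (4 * real (card outside))"
    by (rule real_le_rsqrt)
  then show ?thesis by (simp add: real_sqrt_mult)
qed

text \<open>A gap of at least \<open>n / 2\<close> leaves between \<open>n / 2\<close> and
  \<open>2 * n\<close> reversed pairs, so the evidence has mean at least \<open>\<gamma> * n\<close>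
  and second moment at most \<open>(4 * \<gamma> * n)\<^sup>2 + 2 * n\<close>; at most
  \<open>m\<close> players are outside.\<close>

lemma mean_sgn_ge_explicit:
  assumes R: "0 < R" and g: "n \<le> 2 * (\<pi> j - \<pi> i)" and m: "n \<le> \<pi> j - \<pi> i + m"
  shows "(\<gamma> * n - (16 * \<gamma>\<^sup>2 * (real n)\<^sup>2 + 2 * n) / R) / R - 8 * \<gamma> * (2 * sqrt m + 1) \<le>
    mean n \<gamma> \<pi> (\<lambda>T. sgn (real_of_int (score n T i - score n T j)))"
proof -
  have pj: "\<pi> j < n" using permutes_in_image[OF perm, of j] basic by simp
  have c: "real (card changed) \<le> 2 * real n" "real n / 2 \<le> real (card changed)"
    using card_changed card_between basic pj g by auto
  have o: "card outside \<le> m"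
    using card_outside card_between basic m by linarith
  have "\<gamma> * n \<le> mean n \<gamma> \<pi> evidence"
    unfolding mean_evidence using mult_left_mono[OF c(2) \<gamma>(1)] by simp
  moreover have "mean n \<gamma> \<pi> (\<lambda>T. (real_of_int (evidence T))\<^sup>2) \<le> 16 * \<gamma>\<^sup>2 * (real n)\<^sup>2 + 2 * n"
  proof -
    have "(2 * \<gamma> * card changed)\<^sup>2 \<le> (2 * \<gamma> * (2 * real n))\<^sup>2"
      using \<gamma> c(1) by (intro power_mono mult_left_mono) auto
    with mean_evidence_sq_le c(1) show ?thesis by (simp add: power_mult_distrib)
  qed
  ultimately have "(\<gamma> * n - (16 * \<gamma>\<^sup>2 * (real n)\<^sup>2 + 2 * n) / R) / R \<le>
      (mean n \<gamma> \<pi> evidence - mean n \<gamma> \<pi> (\<lambda>T. (real_of_int (evidence T))\<^sup>2) / R) / R"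
    using R by (intro divide_right_mono diff_mono) auto
  moreover have "8 * \<gamma> * (mean n \<gamma> \<pi> (\<lambda>T. \<bar>noise T\<bar>) + 1) \<le> 8 * \<gamma> * (2 * sqrt m + 1)"
  proof -
    have "2 * sqrt (card outside) \<le> 2 * sqrt m" using o by simp
    with mean_abs_noise_le have "mean n \<gamma> \<pi> (\<lambda>T. \<bar>noise T\<bar>) + 1 \<le> 2 * sqrt m + 1" by linarith
    then show ?thesis using \<gamma> by (intro mult_left_mono) auto
  qed
  ultimately show ?thesis using mean_sgn_ge[OF R] by linarith
qed

end

section \<open>Averaging over pairs and the choice of the constants\<close>

lemma rank_by_score_error_far_pairs:
  assumes \<gamma>: "0 \<le> \<gamma> n" "\<gamma> n \<le> 1 / 4" and n: "2 \<le> n" and q: "4 * q \<le> n" and R: "0 < R"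
    and \<kappa>: "\<kappa> \<le> (\<gamma> n * n - (16 * (\<gamma> n)\<^sup>2 * (real n)\<^sup>2 + 2 * n) / R) / R - 8 * \<gamma> n * (2 * sqrt (2 * q) + 1)"
  shows "recovery_error \<gamma> rank_by_score n \<le> 1 / 2 - \<kappa> * (real q)\<^sup>2 / (real n * (real n - 1))"
proof -
  \<comment> \<open>The first \<open>q\<close> against the last \<open>q\<close> positions: their
    gap exceeds \<open>n - 2 * q\<close>, which is at least \<open>n / 2\<close>, and at most
    \<open>2 * q\<close> players are outside.\<close>
  define far where "far a b = (of_bool (a < q) * of_bool (n - q \<le> b) :: real)" for a b
  have pair: "1 - mean n (\<gamma> n) \<pi> (\<lambda>T. sgn (real_of_int (score n T i - score n T j))) \<le>
      1 - \<kappa> * far (\<pi> i) (\<pi> j)"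
    if \<pi>: "\<pi> permutes {..<n}" and ij: "(i, j) \<in> ordered_pairs n \<pi>" for \<pi> i j
  proof -
    interpret planted_pair n "\<gamma> n" \<pi> i j
      by unfold_locales (use \<gamma> \<pi> ij in auto)
    show ?thesis
    proof (cases "\<pi> i < q \<and> n - q \<le> \<pi> j")
      case True
      then have "n \<le> 2 * (\<pi> j - \<pi> i)" "n \<le> \<pi> j - \<pi> i + 2 * q" using q by auto
      from mean_sgn_ge_explicit[OF R this] \<kappa> True show ?thesis by (simp add: far_def)
    next
      case False
      then have "far (\<pi> i) (\<pi> j) = 0" by (auto simp: far_def)
      with mean_sgn_nonneg show ?thesis by simp
    qed
  qed
  have count: "(\<Sum>b<n. \<Sum>a<b. far a b) = (real q)\<^sup>2"
  proof -
    have "(\<Sum>a<b. far a b) = of_bool (n - q \<le> b) * real q" for b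
    proof (cases "n - q \<le> b")
      case True
      then have "{..<b} \<inter> {..<q} = {..<q}" using q by auto
      with True sum_of_bool_mem[of "{..<b}" "{..<q}"] show ?thesis by (simp add: far_def)
    qed (simp add: far_def)
    then have "(\<Sum>b<n. \<Sum>a<b. far a b) = (\<Sum>b<n. of_bool (n - q \<le> b)) * real q"
      by (simp only: sum_distrib_right)
    also have "(\<Sum>b<n. of_bool (n - q \<le> b)) = real (card ({..<n} \<inter> {n - q..}))"
      using sum_of_bool_mem[of "{..<n}" "{n - q..}"] by (simp only: finite_lessThan atLeast_iff)
    also have "{..<n} \<inter> {n - q..} = {n - q..<n}" by auto
    finally show ?thesis using q by (simp add: power2_eq_square)
  qed
  have "2 * fact n * real (n choose 2) * recovery_error \<gamma> rank_by_score n \<le>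
      (\<Sum>\<pi>\<in>perms n. \<Sum>(i, j)\<in>ordered_pairs n \<pi>. 1 - \<kappa> * far (\<pi> i) (\<pi> j))"
    using \<gamma> n pair by (subst rank_by_score_error[of \<gamma>]) (auto intro!: sum_mono)
  also have "\<dots> = (\<Sum>\<pi>\<in>perms n. real (n choose 2) - \<kappa> * (real q)\<^sup>2)"
  proof (rule sum.cong[OF refl])
    fix \<pi> assume "\<pi> \<in> perms n"
    then have \<pi>: "\<pi> permutes {..<n}" by simp
    have "(\<Sum>(i, j)\<in>ordered_pairs n \<pi>. 1 - \<kappa> * far (\<pi> i) (\<pi> j)) =
        real (card (ordered_pairs n \<pi>)) - \<kappa> * (\<Sum>(i, j)\<in>ordered_pairs n \<pi>. far (\<pi> i) (\<pi> j))"
      by (simp add: case_prod_unfold sum_subtractf sum_distrib_left)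
    then show "(\<Sum>(i, j)\<in>ordered_pairs n \<pi>. 1 - \<kappa> * far (\<pi> i) (\<pi> j)) = real (n choose 2) - \<kappa> * (real q)\<^sup>2"
      by (simp only: sum_ordered_pairs[OF \<pi>, of far] count card_ordered_pairs[OF \<pi>])
  qed
  also have "\<dots> = fact n * (real (n choose 2) - \<kappa> * (real q)\<^sup>2)"
    by (simp add: card_perms)
  finally have "fact n * (2 * real (n choose 2) * recovery_error \<gamma> rank_by_score n) \<le>
      fact n * (real (n choose 2) - \<kappa> * (real q)\<^sup>2)" by (simp only: mult.assoc mult.left_commute)
  then have "2 * real (n choose 2) * recovery_error \<gamma> rank_by_score n \<le> real (n choose 2) - \<kappa> * (real q)\<^sup>2"
    by simp
  moreover define N where "N = real n * (real n - 1)"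
  have choose: "2 * real (n choose 2) = N" unfolding N_def by (rule two_choose_two)
  have "0 < N" using n by (simp add: N_def)
  ultimately have "N * recovery_error \<gamma> rank_by_score n \<le> N / 2 - \<kappa> * (real q)\<^sup>2"
    unfolding choose using choose by linarith
  with \<open>0 < N\<close> show ?thesis unfolding N_def[symmetric] by (simp add: field_simps)
qed

lemma weak_recovery_rank_by_score:
  assumes \<gamma>: "\<And>n. 0 \<le> \<gamma> n" "\<And>n. \<gamma> n \<le> 1 / 4"
    and \<Theta>: "\<gamma> \<in> \<Theta>(\<lambda>n. real n powr (- 1 / 2))"
  shows "weak_recovery \<gamma> rank_by_score"
proof -
  from \<Theta> have O: "\<gamma> \<in> O(\<lambda>n. real n powr (- 1 / 2))" and \<Omega>: "\<gamma> \<in> \<Omega>(\<lambda>n. real n powr (- 1 / 2))"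
    by (auto simp: bigtheta_def)
  from O obtain C where C: "C > 0" "\<forall>\<^sub>F n in sequentially. norm (\<gamma> n) \<le> C * norm (real n powr (- 1 / 2))"
    by (elim landau_o.bigE)
  from \<Omega> obtain c where c: "c > 0" "\<forall>\<^sub>F n in sequentially. norm (\<gamma> n) \<ge> c * norm (real n powr (- 1 / 2))"
    by (elim landau_omega.bigE)
  \<comment> \<open>\<open>K * n\<close> bounds the second moment
    \<open>16 * \<gamma>\<^sup>2 * n\<^sup>2 + 2 * n\<close> when
    \<open>\<gamma> \<le> C / sqrt n\<close>.\<close>
  define K where "K = 16 * C\<^sup>2 + 2"
  have K: "0 < K" by (simp add: K_def add_nonneg_pos)
  \<comment> \<open>Half of the gain \<open>c\<^sup>2 / (4 * K)\<close> at the best truncation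
    level; the other half pays for the noise.\<close>
  define \<kappa> where "\<kappa> = c\<^sup>2 / (8 * K)"
  have \<kappa>: "0 < \<kappa>" using c(1) K by (simp add: \<kappa>_def)
  \<comment> \<open>Small enough for the noise of at most \<open>2 * \<eta> * n\<close> outside
    players to cost at most \<open>\<kappa> / 2\<close>; the \<open>1 / 4\<close> ensures
    \<open>4 * q \<le> n\<close>.\<close>
  define \<eta> where "\<eta> = min (1 / 4) ((\<kappa> / (32 * C))\<^sup>2 / 2)"
  have \<eta>: "0 < \<eta>" "\<eta> \<le> 1 / 4" using \<kappa> C(1) by (auto simp: \<eta>_def)
  have \<eta>_sqrt: "16 * C * sqrt (2 * \<eta>) \<le> \<kappa> / 2"
  proof -
    have "2 * \<eta> \<le> (\<kappa> / (32 * C))\<^sup>2" by (simp add: \<eta>_def min_def)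
    then have "sqrt (2 * \<eta>) \<le> \<kappa> / (32 * C)" using \<kappa> C(1) by (intro real_le_lsqrt) auto
    then show ?thesis using C(1) by (simp add: field_simps)
  qed
  \<comment> \<open>The first term lets rounding \<open>\<eta> * n\<close> down lose at most a
    factor \<open>2\<close>; the second bounds the remaining error \<open>8 * C / sqrt n\<close> by
    \<open>\<kappa> / 2\<close>.\<close>
  define N where "N = nat \<lceil>2 / \<eta> + (16 * C / \<kappa>)\<^sup>2\<rceil> + 2"
  have "\<forall>\<^sub>F n in sequentially. recovery_error \<gamma> rank_by_score n \<le> 1 / 2 - \<kappa> * \<eta>\<^sup>2 / 4"
    using C(2) c(2) eventually_ge_at_top[of N]
  proof eventually_elim
    case (elim n)
    have "2 / \<eta> + (16 * C / \<kappa>)\<^sup>2 \<le> real N" unfolding N_def by linarith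
    moreover have "0 \<le> (16 * C / \<kappa>)\<^sup>2" "0 \<le> 2 / \<eta>" using \<eta> by auto
    ultimately have big: "2 / \<eta> \<le> real n" "(16 * C / \<kappa>)\<^sup>2 \<le> real n" using elim(3) by linarith+
    have n: "2 \<le> n" using elim(3) by (simp add: N_def)
    define s where "s = sqrt (real n)"
    have s: "0 < s" "s * s = real n" using n by (simp_all add: s_def)
    have inv: "real n powr (- 1 / 2) = 1 / s"
      using n by (simp add: s_def powr_minus powr_half_sqrt field_simps)
    have g: "c / s \<le> \<gamma> n" "\<gamma> n \<le> C / s"
      using elim(1,2)[unfolded inv] \<gamma>(1)[of n] s by simp_all
    define q where "q = nat \<lfloor>\<eta> * n\<rfloor>"
    have q: "real q \<le> \<eta> * n" "\<eta> * n - 1 \<le> real q" using \<eta> by (simp_all add: q_def)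
    have "real q \<le> 1 / 4 * n" using q(1) mult_right_mono[OF \<eta>(2), of "real n"] by linarith
    then have q4: "4 * q \<le> n" by linarith
    have "1 \<le> \<eta> * n / 2" using big(1) \<eta> by (simp add: field_simps)
    with q(2) have q2: "\<eta> * n / 2 \<le> real q" by linarith
    \<comment> \<open>Maximises \<open>(x - y / R) / R\<close> for \<open>x = c * s\<close> and
      \<open>y = K * n\<close>: the maximum is at \<open>R = 2 * y / x\<close>, with value
      \<open>x\<^sup>2 / (4 * y) = 2 * \<kappa>\<close>.\<close>
    define R where "R = 2 * K / c * s"
    have R: "0 < R" using K c(1) s by (simp add: R_def)
    have main: "2 * \<kappa> \<le> (\<gamma> n * n - (16 * (\<gamma> n)\<^sup>2 * (real n)\<^sup>2 + 2 * n) / R) / R"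
    proof -
      have "(\<gamma> n)\<^sup>2 \<le> (C / s)\<^sup>2" using g(2) \<gamma>(1) by (intro power_mono) auto
      then have "(\<gamma> n)\<^sup>2 * (real n)\<^sup>2 \<le> (C / s)\<^sup>2 * (s * s)\<^sup>2" unfolding s(2) by (intro mult_right_mono) auto
      also have "\<dots> = C\<^sup>2 * n" using s by (simp add: power2_eq_square field_simps)
      finally have "16 * (\<gamma> n)\<^sup>2 * (real n)\<^sup>2 + 2 * n \<le> K * n" by (simp add: K_def algebra_simps)
      then have "(16 * (\<gamma> n)\<^sup>2 * (real n)\<^sup>2 + 2 * n) / R \<le> K * n / R"
        using R by (intro divide_right_mono) auto
      also have "\<dots> = c * s / 2" using s c(1) K unfolding R_def s(2)[symmetric] by (simp add: field_simps)
      finally have 1: "(16 * (\<gamma> n)\<^sup>2 * (real n)\<^sup>2 + 2 * n) / R \<le> c * s / 2" .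
      have "c / s * (s * s) \<le> \<gamma> n * n" unfolding s(2) using g(1) by (intro mult_right_mono) auto
      then have "c * s \<le> \<gamma> n * n" using s(1) by simp
      with 1 have "c * s / 2 \<le> \<gamma> n * n - (16 * (\<gamma> n)\<^sup>2 * (real n)\<^sup>2 + 2 * n) / R" by linarith
      then have "c * s / 2 / R \<le> (\<gamma> n * n - (16 * (\<gamma> n)\<^sup>2 * (real n)\<^sup>2 + 2 * n) / R) / R"
        using R by (intro divide_right_mono) auto
      moreover have "c * s / 2 / R = 2 * \<kappa>"
        using s(1) c(1) K unfolding R_def \<kappa>_def by (simp add: field_simps power2_eq_square)
      ultimately show ?thesis by simp
    qed
    have err: "8 * \<gamma> n * (2 * sqrt (2 * q) + 1) \<le> \<kappa>"
    proof -
      have "sqrt (2 * real q) \<le> sqrt (2 * \<eta> * n)" using q(1) by simp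
      also have "\<dots> = sqrt (2 * \<eta>) * s" by (simp add: real_sqrt_mult s_def)
      finally have "8 * \<gamma> n * (2 * sqrt (2 * q) + 1) \<le> 8 * (C / s) * (2 * (sqrt (2 * \<eta>) * s) + 1)"
        using g(2) \<gamma>(1)[of n] C(1) s(1) \<eta> by (intro mult_mono add_mono) auto
      also have "\<dots> = 16 * C * sqrt (2 * \<eta>) + 8 * C / s" using s(1) by (simp add: field_simps)
      also have "8 * C / s \<le> \<kappa> / 2"
      proof -
        have "16 * C / \<kappa> \<le> s" unfolding s_def using big(2) by (rule real_le_rsqrt)
        then show ?thesis using s(1) \<kappa> by (simp add: field_simps)
      qed
      finally show ?thesis using \<eta>_sqrt by linarith
    qed
    have "recovery_error \<gamma> rank_by_score n \<le> 1 / 2 - \<kappa> * (real q)\<^sup>2 / (real n * (real n - 1))"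
    proof (rule rank_by_score_error_far_pairs[where \<gamma> = \<gamma>, OF \<gamma> n q4 R])
      show "\<kappa> \<le> (\<gamma> n * n - (16 * (\<gamma> n)\<^sup>2 * (real n)\<^sup>2 + 2 * real n) / R) / R -
          8 * \<gamma> n * (2 * sqrt (2 * real q) + 1)"
        by (rule order_trans[OF _ diff_mono[OF main[unfolded of_nat_mult of_nat_numeral]
              err[unfolded of_nat_mult of_nat_numeral]]]) simp
    qed
    moreover have "\<kappa> * \<eta>\<^sup>2 / 4 \<le> \<kappa> * (real q)\<^sup>2 / (real n * (real n - 1))"
    proof -
      have "\<kappa> * \<eta>\<^sup>2 / 4 * (real n * (real n - 1)) \<le> \<kappa> * \<eta>\<^sup>2 / 4 * (real n * real n)"
        using n \<kappa> by (intro mult_left_mono) auto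
      also have "\<dots> = \<kappa> * (\<eta> * n / 2)\<^sup>2" by (simp add: power2_eq_square)
      also have "\<dots> \<le> \<kappa> * (real q)\<^sup>2"
        using q2 \<kappa> \<eta> by (intro mult_left_mono power_mono) auto
      finally show ?thesis using n by (subst pos_le_divide_eq) auto
    qed
    ultimately show ?case by linarith
  qed
  then have "limsup (\<lambda>n. ereal (recovery_error \<gamma> rank_by_score n)) \<le> ereal (1 / 2 - \<kappa> * \<eta>\<^sup>2 / 4)"
    by (intro Limsup_bounded) (auto elim: eventually_mono)
  moreover have "0 < \<kappa> * \<eta>\<^sup>2 / 4" using \<kappa> \<eta> by simp
  ultimately show ?thesis unfolding weak_recovery_def by blast
qed

theorem theorem2p8:
  fixes \<gamma> :: "nat \<Rightarrow> real"
  assumes "\<And>n. 0 \<le> \<gamma> n" and "\<And>n. \<gamma> n \<le> 1 / 4"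
  shows "(\<gamma> \<in> \<omega>(\<lambda>n. real n powr (- 1 / 2)) \<longrightarrow>
            (\<exists>A. algorithm A \<and> polynomial_time A \<and> strong_recovery \<gamma> A)) \<and>
         (\<gamma> \<in> \<Theta>(\<lambda>n. real n powr (- 1 / 2)) \<longrightarrow>
            \<not> (\<exists>A. algorithm A \<and> strong_recovery \<gamma> A)) \<and>
         (\<gamma> \<in> \<Theta>(\<lambda>n. real n powr (- 1 / 2)) \<longrightarrow>
            (\<exists>A. algorithm A \<and> polynomial_time A \<and> weak_recovery \<gamma> A)) \<and>
         (\<gamma> \<in> o(\<lambda>n. real n powr (- 1 / 2)) \<longrightarrow>
            \<not> (\<exists>A. algorithm A \<and> weak_recovery \<gamma> A))"
  using strong_recovery_rank_by_score[OF assms] no_strong_recovery[OF assms]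
    weak_recovery_rank_by_score[OF assms] no_weak_recovery[OF assms]
    algorithm_rank_by_score polynomial_time_rank_by_score
  by (auto simp: bigtheta_def)

end
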